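(* Let $m,n$ be integers with $n\ge3$ and $p:=m-n\ge1$, and let $G$, $P$ and the matching $\mu$ be as in the context. Let $z=z_1\cdots z_n$ be an injective map with $z_k=1$ for some $k\in[n]$, let $T=[m]\setminus\{z_1,\dots,z_n\}$, and let $\sigma=\{\langle x\rangle:x\in T\}\cup\{f_1,f_2\}\subseteq N(z)$ be a critical $(p+1)$-cell of $\mathcal N(G)$, where $f_1\neq f_2$ are injective maps $[n]\to[m]$. Then there exist two distinct critical $p$-cells $\beta$ and $\gamma$ such that there is exactly one alternating path from $\sigma$ to $\beta$ and exactly one alternating path from $\sigma$ to $\gamma$, and there is no alternating path from $\sigma$ to any other critical $p$-cell.
   Context: $[k]=\{1,\dots,k\}$. Let $G$ be the graph whose vertices are the maps $f:[n]\to[m]$ that are either constant or injective, with $f\sim f'$ iff $f(i)\ne f'(j)$ for all $i\ne j$ in $[n]$ (injective maps have loops). The constant map with value $x$ is denoted $\langle x\rangle$; an injective map $f$ is written as the string $f(1)f(2)\cdots f(n)$. $N(A)$ is the set of common neighbours of a vertex set $A$. The neighbourhood complex $\mathcal N(G)$ has as simplices the nonempty vertex sets with a common neighbour; a $d$-cell is a simplex with $d+1$ elements. $P$ is its set of simplices ordered by inclusion, and $\beta\succ\alpha$ means $\alpha\subset\beta$ with $|\beta|=|\alpha|+1$. Define $S_1=\{\sigma\in P:\langle 1\rangle\notin\sigma,\ \sigma\cup\{\langle1\rangle\}\in P\}$, $\mu_1(\sigma)=\sigma\cup\{\langle1\rangle\}$, $S_1'=P\setminus(S_1\cup\mu_1(S_1))$,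 and for $2\le i\le m$ inductively $S_i=\{\sigma\in S_{i-1}':\langle i\rangle\notin\sigma,\ \sigma\cup\{\langle i\rangle\}\in S'_{i-1}\}$, $\mu_i(\sigma)=\sigma\cup\{\langle i\rangle\}$, $S_i'=S_{i-1}'\setminus(S_i\cup\mu_i(S_i))$. Let $S=\bigcup_i S_i$ and $\mu(\sigma)=\mu_i(\sigma)$ for $\sigma\in S_i$. A simplex is critical if it is not in $S\cup\mu(S)$. For critical cells $\sigma,\alpha$ with $|\sigma|=|\alpha|+1$, an alternating path from $\sigma$ to $\alpha$ is a sequence $(\sigma,y_1,\mu(y_1),\dots,y_t,\mu(y_t),\alpha)$ with $t\ge0$, $y_i\in S$, $\sigma\succ y_1$, $\mu(y_i)\succ y_{i+1}$ for $1\le i<t$, and $\mu(y_t)\succ\alpha$ (for $t=0$ this means $\sigma\succ\alpha$).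
   Formalization: Alternating paths are additionally required to satisfy y_{i+1} ≠ y_i; without this, repeating y_i, μ(y_i) gives infinitely many paths and uniqueness fails, e.g. n=3, m=4, σ={⟨4⟩,123,124}. *)

theory Defs
  imports Main "HOL-Library.FuncSet"
begin

text \<open>Maps from $[n]$ to $[m]$ are the extensional functions in \<open>{1..n} \<rightarrow>\<^sub>E {1..m}\<close>, so that
  equality of functions is equality of maps.\<close>

definition const_map :: "nat \<Rightarrow> nat \<Rightarrow> nat \<Rightarrow> nat" where
  "const_map n x = (\<lambda>i\<in>{1..n}. x)"

definition inj_maps :: "nat \<Rightarrow> nat \<Rightarrow> (nat \<Rightarrow> nat) set" where
  "inj_maps n m = {f \<in> {1..n} \<rightarrow>\<^sub>E {1..m}. inj_on f {1..n}}"

definition verts :: "nat \<Rightarrow> nat \<Rightarrow> (nat \<Rightarrow> nat) set" where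
  "verts n m = const_map n ` {1..m} \<union> inj_maps n m"

definition adj :: "nat \<Rightarrow> (nat \<Rightarrow> nat) \<Rightarrow> (nat \<Rightarrow> nat) \<Rightarrow> bool" where
  "adj n f f' \<longleftrightarrow> (\<forall>i\<in>{1..n}. \<forall>j\<in>{1..n}. i \<noteq> j \<longrightarrow> f i \<noteq> f' j)"

definition common_nbrs :: "nat \<Rightarrow> nat \<Rightarrow> (nat \<Rightarrow> nat) set \<Rightarrow> (nat \<Rightarrow> nat) set" where
  "common_nbrs n m A = {w \<in> verts n m. \<forall>v\<in>A. adj n v w}"

definition nbhd_complex :: "nat \<Rightarrow> nat \<Rightarrow> (nat \<Rightarrow> nat) set set" where
  "nbhd_complex n m = {\<sigma>. \<sigma> \<noteq> {} \<and> \<sigma> \<subseteq> verts n m \<and> common_nbrs n m \<sigma> \<noteq> {}}"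

definition covers :: "'a set \<Rightarrow> 'a set \<Rightarrow> bool" where
  "covers \<beta> \<alpha> \<longleftrightarrow> \<alpha> \<subset> \<beta> \<and> card \<beta> = card \<alpha> + 1"

definition pairable :: "'a \<Rightarrow> 'a set set \<Rightarrow> 'a set set" where
  "pairable v Q = {\<sigma> \<in> Q. v \<notin> \<sigma> \<and> \<sigma> \<union> {v} \<in> Q}"

text \<open>\<open>rest n m i\<close> is $S_i'$, with the convention $S_0' = P$ that makes the recursion uniform in
  $i \ge 1$, and \<open>stage n m i\<close> is $S_i$ (meaningful for $1 \le i \le m$).\<close>

primrec rest :: "nat \<Rightarrow> nat \<Rightarrow> nat \<Rightarrow> (nat \<Rightarrow> nat) set set" where
  "rest n m 0 = nbhd_complex n m"
| "rest n m (Suc i) = rest n m i -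
     (pairable (const_map n (Suc i)) (rest n m i) \<union>
      (\<lambda>\<sigma>. \<sigma> \<union> {const_map n (Suc i)}) ` pairable (const_map n (Suc i)) (rest n m i))"

definition stage :: "nat \<Rightarrow> nat \<Rightarrow> nat \<Rightarrow> (nat \<Rightarrow> nat) set set" where
  "stage n m i = pairable (const_map n i) (rest n m (i - 1))"

definition S :: "nat \<Rightarrow> nat \<Rightarrow> (nat \<Rightarrow> nat) set set" where
  "S n m = (\<Union>i\<in>{1..m}. stage n m i)"

text \<open>The index \<open>i\<close> below is unique for \<open>\<sigma> \<in> S n m\<close> (see \<open>mu_stage\<close>);
  \<open>mu\<close> is only meant to be applied to such \<open>\<sigma>\<close>.\<close>

definition mu :: "nat \<Rightarrow> nat \<Rightarrow> (nat \<Rightarrow> nat) set \<Rightarrow> (nat \<Rightarrow> nat) set" where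
  "mu n m \<sigma> = \<sigma> \<union> {const_map n (THE i. i \<in> {1..m} \<and> \<sigma> \<in> stage n m i)}"

definition critical :: "nat \<Rightarrow> nat \<Rightarrow> (nat \<Rightarrow> nat) set \<Rightarrow> bool" where
  "critical n m \<sigma> \<longleftrightarrow> \<sigma> \<in> nbhd_complex n m \<and> \<sigma> \<notin> S n m \<union> mu n m ` S n m"

definition critical_cell :: "nat \<Rightarrow> nat \<Rightarrow> nat \<Rightarrow> (nat \<Rightarrow> nat) set \<Rightarrow> bool" where
  "critical_cell n m d \<sigma> \<longleftrightarrow> critical n m \<sigma> \<and> card \<sigma> = d + 1"

text \<open>The path $(\sigma, y_1, \mu(y_1), \dots, y_t, \mu(y_t), \alpha)$ is the list \<open>w\<close> of all its
  entries, and \<open>ys\<close> is $y_1, \dots, y_t$.  As always for alternating paths in discrete Morse theory,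
  the step down from $\mu(y_i)$ must not undo the matching step up from $y_i$, i.e.
  $y_{i+1} \neq y_i$; otherwise every path with $t \ge 1$ would yield infinitely many by repeating
  $y_1, \mu(y_1)$.\<close>

definition alt_path ::
  "nat \<Rightarrow> nat \<Rightarrow> (nat \<Rightarrow> nat) set \<Rightarrow> (nat \<Rightarrow> nat) set \<Rightarrow> (nat \<Rightarrow> nat) set list \<Rightarrow> bool" where
  "alt_path n m \<sigma> \<alpha> w \<longleftrightarrow>
     critical n m \<sigma> \<and> critical n m \<alpha> \<and> card \<sigma> = card \<alpha> + 1 \<and>
     (\<exists>ys. w = \<sigma> # concat (map (\<lambda>y. [y, mu n m y]) ys) @ [\<alpha>] \<and>
           set ys \<subseteq> S n m \<and>
           (if ys = [] then covers \<sigma> \<alpha>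
            else covers \<sigma> (hd ys) \<and>
                 (\<forall>i. Suc i < length ys \<longrightarrow>
                    covers (mu n m (ys ! i)) (ys ! Suc i) \<and> ys ! Suc i \<noteq> ys ! i) \<and>
                 covers (mu n m (last ys)) \<alpha>))"

lemma rest_antimono: "i \<le> j \<Longrightarrow> rest n m j \<subseteq> rest n m i"
  by (induction j rule: dec_induct) auto

lemma stage_disjoint:
  assumes "1 \<le> i" "i < j"
  shows "stage n m i \<inter> stage n m j = {}"
proof -
  obtain k where k: "i = Suc k" using assms by (cases i) auto
  have "stage n m j \<subseteq> rest n m (j - 1)" by (auto simp: stage_def pairable_def)
  also have "\<dots> \<subseteq> rest n m i" using assms by (intro rest_antimono) auto
  finally show ?thesis using k by (auto simp: stage_def)
qed

lemma mu_stage: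
  assumes "i \<in> {1..m}" "\<sigma> \<in> stage n m i"
  shows "mu n m \<sigma> = \<sigma> \<union> {const_map n i}"
proof -
  have "(THE i. i \<in> {1..m} \<and> \<sigma> \<in> stage n m i) = i"
  proof (rule the_equality)
    fix j assume "j \<in> {1..m} \<and> \<sigma> \<in> stage n m j"
    then show "j = i"
      using assms stage_disjoint[of i j n m] stage_disjoint[of j i n m]
      by (cases i j rule: linorder_cases) auto
  qed (use assms in auto)
  then show ?thesis by (simp add: mu_def)
qed

end

theory Submission
  imports Defs
begin

text \<open>With a nonempty set \<open>F\<close> of injective maps fixed, the matching is a greedy element matching on the
  sets \<open>X\<close> of constants for which \<open>X \<union> F\<close> is a cell. If \<open>f i = g j\<close> for some \<open>i \<noteq> j\<close>,
  the constant \<open>f i\<close> occurs in no common neighbour of \<open>f, g\<close> and everything is matched; so a critical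
  \<open>\<sigma>\<close> has \<open>f\<^sub>1\<close> and \<open>f\<^sub>2\<close> adjacent. Then the sets \<open>D j = {f\<^sub>1 j, f\<^sub>2 j}\<close> are disjoint, and with \<open>C\<close>
  the set of the remaining constants, \<open>X\<close> gives a cell iff it does not contain \<open>C\<close> or contains no \<open>D j\<close>.
  The greedy matching on this complex is explicit and leaves a single critical \<open>X\<close>; the same holds
  for a single map (take \<open>f = g\<close>).

  A path starting at \<open>\<sigma>\<close> survives only as long as the complement of \<open>X\<close> is the image of some \<open>z\<close>
  with \<open>z k = 1\<close> and \<open>z j \<in> D j\<close> for \<open>j \<noteq> k\<close>. It begins with \<open>z j = min (D j)\<close>, and each step raises
  one entry to \<open>max (D j)\<close>, in decreasing order of \<open>min (D j)\<close>. Dropping the other map leads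
  to the critical cell over \<open>h \<in> {f\<^sub>1, f\<^sub>2}\<close> only when \<open>z j = h j\<close> for all \<open>j \<noteq> k\<close>, so \<open>h\<close> determines
  the set of entries to raise, their order is forced, and each \<open>h\<close> is reached by exactly one path.\<close>

section \<open>The greedy matching and alternating paths\<close>

definition toggle :: "'a \<Rightarrow> 'a set \<Rightarrow> 'a set" where
  "toggle v X = (if v \<in> X then X - {v} else insert v X)"

lemma toggle_commute: "toggle u (toggle v X) = toggle v (toggle u X)"
  by (auto simp: toggle_def)

text \<open>Being in \<open>pairable\<close> and being in its image are the cases "constant absent"
  and "constant present" of a single condition: the partner under \<open>toggle\<close> is left over
  as well. A stage therefore keeps exactly the cells whose partner is not left over.\<close>

lemma rest_Suc_iff:
  "\<sigma> \<in> rest n m (Suc i) \<longleftrightarrow>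
     \<sigma> \<in> rest n m i \<and> toggle (const_map n (Suc i)) \<sigma> \<notin> rest n m i"
proof (cases "const_map n (Suc i) \<in> \<sigma>")
  case True
  let ?v = "const_map n (Suc i)"
  have "\<sigma> \<in> (\<lambda>\<sigma>. \<sigma> \<union> {?v}) ` pairable ?v (rest n m i) \<longleftrightarrow> \<sigma> - {?v} \<in> rest n m i"
    if "\<sigma> \<in> rest n m i"
  proof
    assume "\<sigma> \<in> (\<lambda>\<sigma>. \<sigma> \<union> {?v}) ` pairable ?v (rest n m i)"
    then obtain \<tau> where "\<tau> \<in> rest n m i" "?v \<notin> \<tau>" "\<sigma> = insert ?v \<tau>"
      by (auto simp: pairable_def)
    then show "\<sigma> - {?v} \<in> rest n m i" by simp
  next
    assume "\<sigma> - {?v} \<in> rest n m i"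
    then have "\<sigma> - {?v} \<in> pairable ?v (rest n m i)"
      using that True by (simp add: pairable_def insert_absorb)
    then show "\<sigma> \<in> (\<lambda>\<sigma>. \<sigma> \<union> {?v}) ` pairable ?v (rest n m i)"
      using True by (intro image_eqI[of _ _ "\<sigma> - {?v}"]) auto
  qed
  then show ?thesis using True by (auto simp: toggle_def pairable_def)
next
  case False
  then show ?thesis by (auto simp: toggle_def pairable_def)
qed

lemma rest_eq:
  "rest n m i = nbhd_complex n m -
     (\<Union>j\<in>{1..i}. stage n m j \<union> (\<lambda>\<sigma>. \<sigma> \<union> {const_map n j}) ` stage n m j)"
proof (induction i)
  case (Suc i)
  have "rest n m (Suc i) = rest n m i -
      (stage n m (Suc i) \<union> (\<lambda>\<sigma>. \<sigma> \<union> {const_map n (Suc i)}) ` stage n m (Suc i))"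
    by (simp add: stage_def)
  moreover have "{1..Suc i} = insert (Suc i) {1..i}" by auto
  ultimately show ?case by (simp only: Suc.IH UN_insert) blast
qed simp

lemma mu_image_stage:
  "i \<in> {1..m} \<Longrightarrow> mu n m ` stage n m i = (\<lambda>\<sigma>. \<sigma> \<union> {const_map n i}) ` stage n m i"
  by (intro image_cong) (auto simp: mu_stage)

text \<open>On \<open>stage n m i\<close> the map \<open>mu\<close> adds the constant i, so the
  stages and their partners removed up to m make up precisely \<open>S\<close> and its
  image.\<close>

lemma critical_iff_rest: "critical n m \<sigma> \<longleftrightarrow> \<sigma> \<in> rest n m m"
proof -
  have "S n m \<union> mu n m ` S n m =
      (\<Union>j\<in>{1..m}. stage n m j \<union> (\<lambda>\<sigma>. \<sigma> \<union> {const_map n j}) ` stage n m j)"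
    unfolding S_def image_UN using mu_image_stage[of _ m n] by (simp add: UN_Un_distrib)
  then show ?thesis by (simp add: critical_def rest_eq[of n m m])
qed

lemma matched_up:
  assumes "i < m" "\<sigma> \<in> rest n m i" "const_map n (Suc i) \<notin> \<sigma>"
    and "insert (const_map n (Suc i)) \<sigma> \<in> rest n m i"
  shows "\<sigma> \<in> S n m" "mu n m \<sigma> = insert (const_map n (Suc i)) \<sigma>"
proof -
  have st: "\<sigma> \<in> stage n m (Suc i)" using assms by (auto simp: stage_def pairable_def)
  with \<open>i < m\<close> show "\<sigma> \<in> S n m" by (force simp: S_def)
  show "mu n m \<sigma> = insert (const_map n (Suc i)) \<sigma>"
    using mu_stage[OF _ st] \<open>i < m\<close> by simp
qed

text \<open>Such a cell is the upper partner at stage \<open>Suc i\<close>. It is not in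
  \<open>S\<close>: members of earlier stages are already missing from \<open>rest n m i\<close>,
  members of stage \<open>Suc i\<close> lack this constant, and later stages draw from
  \<open>rest n m (Suc i)\<close>.\<close>

lemma matched_down:
  assumes "i < m" "\<sigma> \<in> rest n m i" "const_map n (Suc i) \<in> \<sigma>"
    and "\<sigma> - {const_map n (Suc i)} \<in> rest n m i"
  shows "\<sigma> \<notin> S n m" "\<not> critical n m \<sigma>"
proof -
  have out: "\<sigma> \<notin> rest n m (Suc i)"
    using assms by (simp add: rest_Suc_iff toggle_def del: rest.simps)
  show "\<sigma> \<notin> S n m"
  proof
    assume "\<sigma> \<in> S n m"
    then obtain j where j: "1 \<le> j" "\<sigma> \<in> stage n m j" by (auto simp: S_def)
    consider "j \<le> i" | "j = Suc i" | "Suc i \<le> j - 1" by linarith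
    then show False
    proof cases
      case 1
      then have "\<sigma> \<notin> rest n m i" using j by (auto simp: rest_eq[of n m i])
      with assms show False by simp
    next
      case 2
      with j assms show False by (simp add: stage_def pairable_def)
    next
      case 3
      with j out rest_antimono[OF 3, of n m] show False
        by (auto simp: stage_def pairable_def simp del: rest.simps)
    qed
  qed
  show "\<not> critical n m \<sigma>"
    using out rest_antimono[of "Suc i" m n m] \<open>i < m\<close>
    by (auto simp: critical_iff_rest simp del: rest.simps)
qed

lemma S_not_critical: "\<sigma> \<in> S n m \<Longrightarrow> \<not> critical n m \<sigma>"
  by (simp add: critical_def)

section \<open>Facets, and alternating paths as a recursion\<close>

lemma covers_iff:
  assumes "finite \<beta>"
  shows "covers \<beta> \<alpha> \<longleftrightarrow> (\<exists>x\<in>\<beta>. \<alpha> = \<beta> - {x})"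
proof
  assume c: "covers \<beta> \<alpha>"
  then have "\<alpha> \<subseteq> \<beta>" by (auto simp: covers_def)
  with c assms have "card (\<beta> - \<alpha>) = 1"
    by (simp add: covers_def card_Diff_subset finite_subset)
  then obtain x where "\<beta> - \<alpha> = {x}" by (auto simp: card_1_singleton_iff)
  with \<open>\<alpha> \<subseteq> \<beta>\<close> show "\<exists>x\<in>\<beta>. \<alpha> = \<beta> - {x}" by (intro bexI[of _ x]) auto
next
  assume "\<exists>x\<in>\<beta>. \<alpha> = \<beta> - {x}"
  then obtain x where x: "x \<in> \<beta>" "\<alpha> = \<beta> - {x}" by auto
  then show "covers \<beta> \<alpha>"
    using card_Suc_Diff1[OF assms x(1)] by (auto simp: covers_def)
qed

lemma covers_neq: "covers \<beta> \<alpha> \<Longrightarrow> \<alpha> \<noteq> \<beta>"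
  by (auto simp: covers_def)

text \<open>The argument \<open>q\<close> is the cell from which the last matching step went up; the
  next entry must differ from it. The recursion replaces the indexed conditions of
  \<open>alt_path\<close> by one choice at a time.\<close>

fun path_from ::
  "nat \<Rightarrow> nat \<Rightarrow> (nat \<Rightarrow> nat) set \<Rightarrow> (nat \<Rightarrow> nat) set \<Rightarrow> (nat \<Rightarrow> nat) set list \<Rightarrow>
   (nat \<Rightarrow> nat) set \<Rightarrow> bool" where
  "path_from n m q \<tau> [] \<alpha> \<longleftrightarrow> covers \<tau> \<alpha>"
| "path_from n m q \<tau> (y # ys) \<alpha> \<longleftrightarrow>
     y \<in> S n m \<and> covers \<tau> y \<and> y \<noteq> q \<and> path_from n m y (mu n m y) ys \<alpha>"

lemma path_from_iff:
  "path_from n m q \<tau> ys \<alpha> \<longleftrightarrow>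
     set ys \<subseteq> S n m \<and>
     (if ys = [] then covers \<tau> \<alpha>
      else covers \<tau> (hd ys) \<and> hd ys \<noteq> q \<and>
           (\<forall>i. Suc i < length ys \<longrightarrow>
              covers (mu n m (ys ! i)) (ys ! Suc i) \<and> ys ! Suc i \<noteq> ys ! i) \<and>
           covers (mu n m (last ys)) \<alpha>)"
proof (induction ys arbitrary: q \<tau>)
  case (Cons y ys)
  have "(\<forall>i. Suc i < length (y # ys) \<longrightarrow>
           covers (mu n m ((y # ys) ! i)) ((y # ys) ! Suc i) \<and> (y # ys) ! Suc i \<noteq> (y # ys) ! i) \<longleftrightarrow>
        (ys \<noteq> [] \<longrightarrow> covers (mu n m y) (hd ys) \<and> hd ys \<noteq> y) \<and>
        (\<forall>i. Suc i < length ys \<longrightarrow> covers (mu n m (ys ! i)) (ys ! Suc i) \<and> ys ! Suc i \<noteq> ys ! i)"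
    (is "?L \<longleftrightarrow> ?R")
  proof
    assume L: ?L
    have "covers (mu n m y) (hd ys) \<and> hd ys \<noteq> y" if "ys \<noteq> []"
      using L[rule_format, of 0] that by (simp add: hd_conv_nth)
    moreover have "covers (mu n m (ys ! i)) (ys ! Suc i) \<and> ys ! Suc i \<noteq> ys ! i"
      if "Suc i < length ys" for i
      using L[rule_format, of "Suc i"] that by simp
    ultimately show ?R by blast
  next
    assume R: ?R
    show ?L
    proof (intro allI impI)
      fix i assume "Suc i < length (y # ys)"
      then show "covers (mu n m ((y # ys) ! i)) ((y # ys) ! Suc i) \<and>
          (y # ys) ! Suc i \<noteq> (y # ys) ! i"
        using R by (cases i) (auto simp: hd_conv_nth)
    qed
  qed
  then show ?case using Cons.IH[of y "mu n m y"] by auto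
qed simp

text \<open>Starting with \<open>q\<close> equal to \<sigma> imposes nothing, because a covered cell
  always differs from \<sigma>.\<close>

lemma alt_path_iff:
  "alt_path n m \<sigma> \<alpha> w \<longleftrightarrow>
     critical n m \<sigma> \<and> critical n m \<alpha> \<and> card \<sigma> = card \<alpha> + 1 \<and>
     (\<exists>ys. w = \<sigma> # concat (map (\<lambda>y. [y, mu n m y]) ys) @ [\<alpha>] \<and> path_from n m \<sigma> \<sigma> ys \<alpha>)"
proof -
  have "covers \<sigma> y \<and> y \<noteq> \<sigma> \<and> Q \<longleftrightarrow> covers \<sigma> y \<and> Q" for y Q
    using covers_neq[of \<sigma> y] by auto
  then show ?thesis by (simp only: alt_path_def path_from_iff)
qed

lemma alt_path_ex1:
  assumes crit: "critical n m \<sigma>" "critical n m \<alpha>" "card \<sigma> = card \<alpha> + 1"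
    and ex: "\<exists>!ys. path_from n m \<sigma> \<sigma> ys \<alpha>"
  shows "\<exists>!w. alt_path n m \<sigma> \<alpha> w"
proof -
  obtain ys where ys: "path_from n m \<sigma> \<sigma> ys \<alpha>"
    and uniq: "\<And>zs. path_from n m \<sigma> \<sigma> zs \<alpha> \<Longrightarrow> zs = ys" using ex by auto
  show ?thesis
  proof (rule ex1I)
    show "alt_path n m \<sigma> \<alpha> (\<sigma> # concat (map (\<lambda>y. [y, mu n m y]) ys) @ [\<alpha>])"
      unfolding alt_path_iff using crit ys by blast
  next
    fix w assume "alt_path n m \<sigma> \<alpha> w"
    then show "w = \<sigma> # concat (map (\<lambda>y. [y, mu n m y]) ys) @ [\<alpha>]"
      unfolding alt_path_iff using uniq by blast
  qed
qed

section \<open>Cells as pairs of constants and injective maps\<close>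

definition cell :: "nat \<Rightarrow> nat set \<Rightarrow> (nat \<Rightarrow> nat) set \<Rightarrow> (nat \<Rightarrow> nat) set" where
  "cell n X F = const_map n ` X \<union> F"

text \<open>The matching adds or removes constants only, so both cells of a matched pair have the
  same injective part \<open>F\<close>. For fixed \<open>F\<close> each stage becomes a family of
  sets of numbers.\<close>

definition live :: "nat \<Rightarrow> nat \<Rightarrow> (nat \<Rightarrow> nat) set \<Rightarrow> nat \<Rightarrow> nat set \<Rightarrow> bool" where
  "live n m F i X \<longleftrightarrow> cell n X F \<in> rest n m i"

lemma const_map_eq_iff:
  assumes "1 \<le> n" shows "const_map n x = const_map n y \<longleftrightarrow> x = y"
proof
  assume "const_map n x = const_map n y"
  then have "const_map n x 1 = const_map n y 1" by (rule fun_cong)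
  with assms show "x = y" by (simp add: const_map_def)
qed simp

lemma const_map_notin_inj_maps:
  assumes "2 \<le> n" shows "const_map n x \<notin> inj_maps n m"
proof
  assume "const_map n x \<in> inj_maps n m"
  then have "inj_on (const_map n x) {1..n}" by (simp add: inj_maps_def)
  from inj_onD[OF this, of 1 2] assms show False by (simp add: const_map_def)
qed

text \<open>If w takes the value x at j, then \<open>2 \<le> n\<close> supplies a second position,
  where the constant map has the value x too.\<close>

lemma adj_const_map:
  assumes "2 \<le> n"
  shows "adj n (const_map n x) w \<longleftrightarrow> x \<notin> w ` {1..n}"
proof
  assume a: "adj n (const_map n x) w"
  show "x \<notin> w ` {1..n}"
  proof
    assume "x \<in> w ` {1..n}"
    then obtain j where j: "j \<in> {1..n}" "w j = x" by auto
    obtain i where "i \<in> {1..n}" "i \<noteq> j"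
    proof
      show "(if j = 1 then 2 else 1) \<in> {1..n}" using assms by simp
    qed simp
    with a j have "const_map n x i \<noteq> w j" unfolding adj_def by blast
    with \<open>i \<in> {1..n}\<close> j show False by (simp add: const_map_def)
  qed
qed (auto simp: adj_def const_map_def)

lemma inj_mapsD:
  assumes "f \<in> inj_maps n m"
  shows "\<And>i. i \<in> {1..n} \<Longrightarrow> f i \<in> {1..m}" "inj_on f {1..n}" "card (f ` {1..n}) = n"
    "f ` {1..n} \<subseteq> {1..m}"
proof -
  have f: "f \<in> {1..n} \<rightarrow>\<^sub>E {1..m}" and inj: "inj_on f {1..n}" using assms by (simp_all add: inj_maps_def)
  show mem: "f i \<in> {1..m}" if "i \<in> {1..n}" for i using PiE_mem[OF f that] .
  show "inj_on f {1..n}" by (fact inj)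
  show "card (f ` {1..n}) = n" using card_image[OF inj] by simp
  show "f ` {1..n} \<subseteq> {1..m}" using mem by blast
qed

lemma mem_cell_const_map:
  assumes "2 \<le> n" "F \<subseteq> inj_maps n m"
  shows "const_map n x \<in> cell n X F \<longleftrightarrow> x \<in> X"
proof -
  have "const_map n x \<notin> F" using assms const_map_notin_inj_maps by blast
  moreover have "const_map n x \<in> const_map n ` X \<longleftrightarrow> x \<in> X"
    using const_map_eq_iff[of n] assms(1) by (simp add: image_iff)
  ultimately show ?thesis by (simp add: cell_def)
qed

lemma cell_insert: "cell n (insert x X) F = insert (const_map n x) (cell n X F)"
  by (simp add: cell_def)

lemma cell_remove:
  assumes "2 \<le> n" "F \<subseteq> inj_maps n m"
  shows "cell n X F - {const_map n x} = cell n (X - {x}) F"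
proof -
  have "const_map n x \<notin> F" using assms const_map_notin_inj_maps by blast
  moreover have "const_map n ` X - {const_map n x} = const_map n ` (X - {x})"
    using const_map_eq_iff[of n] assms(1) by auto
  ultimately show ?thesis unfolding cell_def by blast
qed

lemma cell_remove_map:
  assumes "2 \<le> n" "f \<in> inj_maps n m"
  shows "cell n X F - {f} = cell n X (F - {f})"
  using const_map_notin_inj_maps[OF assms(1)] assms(2) unfolding cell_def by blast

lemma toggle_cell:
  "\<lbrakk>2 \<le> n; F \<subseteq> inj_maps n m\<rbrakk> \<Longrightarrow> toggle (const_map n x) (cell n X F) = cell n (toggle x X) F"
  by (simp add: toggle_def mem_cell_const_map cell_remove cell_insert)

lemma cell_eq_iff:
  assumes "2 \<le> n" "F \<subseteq> inj_maps n m" "G \<subseteq> inj_maps n m"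
  shows "cell n X F = cell n Y G \<longleftrightarrow> X = Y \<and> F = G"
proof
  assume eq: "cell n X F = cell n Y G"
  have "x \<in> X \<longleftrightarrow> x \<in> Y" for x
    using mem_cell_const_map[OF assms(1,2), of x X] mem_cell_const_map[OF assms(1,3), of x Y] eq
    by simp
  then have "X = Y" by auto
  moreover have "cell n Z H \<inter> inj_maps n m = H" if "H \<subseteq> inj_maps n m" for Z H
    using that const_map_notin_inj_maps[OF assms(1), of _ m] unfolding cell_def by blast
  ultimately show "X = Y \<and> F = G" using eq assms(2,3) by metis
qed simp

lemma card_cell:
  assumes "2 \<le> n" "F \<subseteq> inj_maps n m" "finite X" "finite F"
  shows "card (cell n X F) = card X + card F"
proof -
  have "card (cell n X F) = card (const_map n ` X) + card F"
    unfolding cell_def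
  proof (rule card_Un_disjoint)
    show "const_map n ` X \<inter> F = {}" using assms const_map_notin_inj_maps by blast
  qed (use assms in auto)
  moreover have "inj_on (const_map n) X" using assms by (auto simp: inj_on_def const_map_eq_iff)
  ultimately show ?thesis by (simp add: card_image)
qed

text \<open>By \<open>adj_const_map\<close>, a constant in the cell only forbids its value to a
  common neighbour, which must otherwise be a common neighbour of \<open>F\<close>.\<close>

lemma cell_in_nbhd_complex_iff:
  assumes "2 \<le> n" "F \<subseteq> inj_maps n m" "X \<subseteq> {1..m}" "X \<noteq> {} \<or> F \<noteq> {}"
  shows "cell n X F \<in> nbhd_complex n m \<longleftrightarrow>
    (\<exists>w\<in>common_nbrs n m F. w ` {1..n} \<inter> X = {})"
proof -
  have "cell n X F \<subseteq> verts n m" using assms(2,3) unfolding cell_def verts_def by blast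
  moreover have "cell n X F \<noteq> {}" using assms(4) by (simp add: cell_def)
  moreover have "common_nbrs n m (cell n X F) = {w \<in> common_nbrs n m F. \<forall>x\<in>X. x \<notin> w ` {1..n}}"
    unfolding cell_def common_nbrs_def using adj_const_map[OF assms(1)] by blast
  ultimately show ?thesis unfolding nbhd_complex_def by blast
qed

lemma live_Suc_iff:
  "\<lbrakk>2 \<le> n; F \<subseteq> inj_maps n m\<rbrakk> \<Longrightarrow>
     live n m F (Suc i) X \<longleftrightarrow> live n m F i X \<and> \<not> live n m F i (toggle (Suc i) X)"
  unfolding live_def by (simp only: rest_Suc_iff toggle_cell)

lemma toggle_subset: "\<lbrakk>v \<in> A; X \<subseteq> A\<rbrakk> \<Longrightarrow> toggle v X \<subseteq> A"
  by (auto simp: toggle_def)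

text \<open>Toggling a constant that occurs in no common neighbour of \<open>F\<close> is a symmetry of every stage,
  so the stage belonging to that constant matches everything that is left.\<close>

lemma not_critical_of_unused:
  assumes n: "2 \<le> n" and F: "F \<subseteq> inj_maps n m" "F \<noteq> {}" and e: "e \<in> {1..m}"
    and unused: "\<And>w. w \<in> common_nbrs n m F \<Longrightarrow> e \<notin> w ` {1..n}"
    and X: "X \<subseteq> {1..m}"
  shows "\<not> critical n m (cell n X F)"
proof -
  \<comment> \<open>The symmetry passes from stage to stage because toggling \<open>e\<close>
    commutes with toggling the constant of the stage.\<close>
  have sym: "live n m F i (toggle e Y) \<longleftrightarrow> live n m F i Y" if "Y \<subseteq> {1..m}" "i \<le> m" for i Y
    using that
  proof (induction i arbitrary: Y)
    case 0
    have "w ` {1..n} \<inter> toggle e Y = {} \<longleftrightarrow> w ` {1..n} \<inter> Y = {}"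
      if "w \<in> common_nbrs n m F" for w
      using unused[OF that] by (auto simp: toggle_def)
    then show ?case
      using cell_in_nbhd_complex_iff[OF n F(1) 0(1)]
        cell_in_nbhd_complex_iff[OF n F(1) toggle_subset[OF e 0(1)]] F(2)
      by (auto simp: live_def)
  next
    case (Suc i)
    have "toggle (Suc i) Y \<subseteq> {1..m}" using Suc.prems by (intro toggle_subset) auto
    then show ?case
      using Suc by (simp add: live_Suc_iff[OF n F(1)] toggle_commute[of "Suc i" e])
  qed
  obtain i where i: "e = Suc i" "i < m" using e by (cases e) auto
  \<comment> \<open>At stage \<open>e\<close> the partner of \<open>X\<close> is
    \<open>toggle e X\<close>, which is left over before that stage exactly when \<open>X\<close>
    is.\<close>
  have "\<not> live n m F e X"
    using sym[of X i] X i by (simp add: live_Suc_iff[OF n F(1)])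
  then show ?thesis
    using rest_antimono[of e m n m] e by (auto simp: critical_iff_rest live_def)
qed

text \<open>Dropping the constant 1 leaves a nonempty subset of a cell, hence a cell, so the first
  stage makes \<tau> an upper partner.\<close>

lemma const_1_dead:
  assumes "1 \<le> m" "\<tau> \<in> nbhd_complex n m" "const_map n 1 \<in> \<tau>" "\<tau> \<noteq> {const_map n 1}"
  shows "\<tau> \<notin> S n m" "\<not> critical n m \<tau>"
proof -
  have "common_nbrs n m \<tau> \<subseteq> common_nbrs n m (\<tau> - {const_map n 1})"
    by (auto simp: common_nbrs_def)
  with assms have "\<tau> - {const_map n 1} \<in> nbhd_complex n m"
    unfolding nbhd_complex_def by blast
  then show "\<tau> \<notin> S n m" "\<not> critical n m \<tau>"
    using matched_down[of 0 m \<tau> n] assms by auto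
qed

lemma nbhd_complex_mono:
  assumes "\<tau> \<in> nbhd_complex n m" "\<rho> \<subseteq> \<tau>" "\<rho> \<noteq> {}"
  shows "\<rho> \<in> nbhd_complex n m"
proof -
  have "common_nbrs n m \<tau> \<subseteq> common_nbrs n m \<rho>"
    using assms by (auto simp: common_nbrs_def)
  with assms show ?thesis unfolding nbhd_complex_def by blast
qed

text \<open>The first stage matches \<open>y\<close> by adding the constant 1. Every facet of
  \<open>mu n m y\<close> other than \<open>y\<close> keeps this constant and, as
  \<open>1 < card y\<close>, some further element; \<open>const_1_dead\<close> stops the path
  there.\<close>

lemma no_path_through:
  assumes "1 \<le> m" "finite y" "1 < card y" "const_map n 1 \<notin> y"
    and P: "insert (const_map n 1) y \<in> nbhd_complex n m" and \<alpha>: "critical n m \<alpha>"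
  shows "\<not> path_from n m y (mu n m y) ys \<alpha>" "\<not> critical n m y"
proof -
  have "y \<noteq> {}" using assms by auto
  have y: "y \<in> nbhd_complex n m" by (rule nbhd_complex_mono[OF P]) (use \<open>y \<noteq> {}\<close> in auto)
  have up: "y \<in> S n m" "mu n m y = insert (const_map n 1) y"
    using matched_up[of 0 m y n] assms y by auto
  show ncrit: "\<not> critical n m y" using up(1) by (rule S_not_critical)
  have dead: "\<tau> \<notin> S n m \<and> \<not> critical n m \<tau>"
    if c: "covers (mu n m y) \<tau>" and neq: "\<tau> \<noteq> y" for \<tau>
  proof -
    have fin: "finite (mu n m y)" using up assms(2) by simp
    obtain x where x: "x \<in> mu n m y" "\<tau> = mu n m y - {x}" using c covers_iff[OF fin] by auto
    then have c1: "const_map n 1 \<in> \<tau>" using up assms(4) neq by auto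
    have "card \<tau> = card y" using x fin up assms(2,4) by auto
    with \<open>1 < card y\<close> have ne: "\<tau> \<noteq> {const_map n 1}" by auto
    have "\<tau> \<in> nbhd_complex n m"
      by (rule nbhd_complex_mono[OF P]) (use x up c1 in auto)
    with const_1_dead[OF \<open>1 \<le> m\<close> _ c1 ne] show ?thesis by blast
  qed
  show "\<not> path_from n m y (mu n m y) ys \<alpha>"
    using dead ncrit \<alpha> by (cases ys) auto
qed

section \<open>The matching over an adjacent pair\<close>

text \<open>\<open>f = g\<close> is allowed and handles single maps. The position \<open>k\<close> is where the least value \<open>a\<close> of
  the two maps occurs; in the context of a critical \<open>\<sigma> \<subseteq> N(z)\<close> it is the position with \<open>z k = 1\<close>.\<close>

locale adjacent_pair =
  fixes n m k a :: nat and f g :: "nat \<Rightarrow> nat"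
  assumes n2: "2 \<le> n"
    and f: "f \<in> inj_maps n m" and g: "g \<in> inj_maps n m"
    and adj: "adj n f g"
    and k: "k \<in> {1..n}"
    and a: "a \<in> {f k, g k}"
    and a_le: "\<And>j. j \<in> {1..n} \<Longrightarrow> a \<le> f j \<and> a \<le> g j"
begin

definition D :: "nat \<Rightarrow> nat set" where "D j = {f j, g j}"

definition C :: "nat set" where "C = {1..m} - (\<Union>j\<in>{1..n}. D j)"

definition low :: "nat \<Rightarrow> nat" where "low j = min (f j) (g j)"

text \<open>Explicit form, valid for \<open>i \<ge> a\<close>, of what the first \<open>i\<close> stages leave over.\<close>

definition unmatched :: "nat \<Rightarrow> nat set \<Rightarrow> bool" where
  "unmatched i X \<longleftrightarrow> X \<subseteq> {1..m} \<and> 1 \<notin> X \<and> C \<union> D k - {1} \<subseteq> X \<and>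
     (\<forall>j\<in>{1..n} - {k}. \<not> D j \<subseteq> X \<and> (low j \<le> i \<longrightarrow> D j - {low j} \<subseteq> X))"

lemma F: "{f, g} \<subseteq> inj_maps n m" using f g by simp

lemma D_subset: "j \<in> {1..n} \<Longrightarrow> D j \<subseteq> {1..m}"
  using inj_mapsD(1)[OF f] inj_mapsD(1)[OF g] by (auto simp: D_def)

text \<open>Injectivity separates the values of one map at different positions, adjacency those of
  the two maps.\<close>

lemma D_disjoint: "\<lbrakk>i \<in> {1..n}; j \<in> {1..n}; x \<in> D i; x \<in> D j\<rbrakk> \<Longrightarrow> i = j"
  using inj_onD[OF inj_mapsD(2)[OF f], of i j] inj_onD[OF inj_mapsD(2)[OF g], of i j] adj
  unfolding adj_def D_def by (metis empty_iff insert_iff)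

lemma low_mem: "low j \<in> D j" by (auto simp: low_def D_def min_def)

lemma low_le: "x \<in> D j \<Longrightarrow> low j \<le> x" by (auto simp: low_def D_def)

lemma a_le_D: "\<lbrakk>j \<in> {1..n}; x \<in> D j\<rbrakk> \<Longrightarrow> a \<le> x" using a_le by (auto simp: D_def)

lemma a_mem: "a \<in> D k" using a by (simp add: D_def)

lemma a_range: "1 \<le> a" "a \<le> m" using a_mem D_subset[OF k] by auto

lemma C_subset: "C \<subseteq> {1..m}" by (auto simp: C_def)

lemma C_D_cases:
  assumes "x \<in> {1..m}" obtains "x \<in> C" | j where "j \<in> {1..n}" "x \<in> D j"
  using assms unfolding C_def by blast

lemma C_D_disjoint: "\<lbrakk>j \<in> {1..n}; x \<in> D j\<rbrakk> \<Longrightarrow> x \<notin> C" by (auto simp: C_def)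

lemma common_nbr_inj:
  assumes "w \<in> inj_maps n m" "w \<in> common_nbrs n m {f, g}" "j \<in> {1..n}"
  shows "w j \<in> C \<union> D j"
proof -
  have "f i \<noteq> w j" "g i \<noteq> w j" if "i \<in> {1..n}" "i \<noteq> j" for i
    using assms that by (auto simp: common_nbrs_def adj_def)
  moreover have "w j \<in> {1..m}" using inj_mapsD(1)[OF assms(1,3)] .
  ultimately show ?thesis
  proof (elim C_D_cases)
    fix i assume i: "i \<in> {1..n}" "w j \<in> D i" and "\<And>i. \<lbrakk>i \<in> {1..n}; i \<noteq> j\<rbrakk> \<Longrightarrow> f i \<noteq> w j"
      "\<And>i. \<lbrakk>i \<in> {1..n}; i \<noteq> j\<rbrakk> \<Longrightarrow> g i \<noteq> w j"
    with i(1) have "i \<noteq> j \<Longrightarrow> w j \<notin> D i" by (metis D_def empty_iff insert_iff)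
    with i have "i = j" by blast
    with i show ?thesis by simp
  qed simp
qed

lemma common_nbrI:
  assumes w: "w \<in> {1..n} \<rightarrow>\<^sub>E {1..m}" and CD: "\<And>j. j \<in> {1..n} \<Longrightarrow> w j \<in> C \<union> D j"
    and inj: "inj_on w {1..n}"
  shows "w \<in> common_nbrs n m {f, g}"
proof -
  have "f i \<noteq> w j \<and> g i \<noteq> w j" if "i \<in> {1..n}" "j \<in> {1..n}" "i \<noteq> j" for i j
    using CD[OF that(2)] D_disjoint[OF that(1,2), of "w j"] C_D_disjoint[OF that(1), of "w j"] that(3)
    by (auto simp: D_def)
  with w inj show ?thesis by (auto simp: common_nbrs_def verts_def inj_maps_def adj_def)
qed

text \<open>A constant common neighbour has its value in \<open>C\<close>, and it serves if this
  value is missing from \<open>X\<close>. If \<open>C \<subseteq> X\<close>, an injective common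
  neighbour must pick at each j an element of \<open>D j\<close> outside \<open>X\<close>; any such
  choice is injective, the \<open>D j\<close> being disjoint.\<close>

lemma live_0_iff:
  assumes "X \<subseteq> {1..m}"
  shows "live n m {f, g} 0 X \<longleftrightarrow> \<not> C \<subseteq> X \<or> (\<forall>j\<in>{1..n}. \<not> D j \<subseteq> X)"
proof -
  have "live n m {f, g} 0 X \<longleftrightarrow> (\<exists>w\<in>common_nbrs n m {f, g}. w ` {1..n} \<inter> X = {})"
    using cell_in_nbhd_complex_iff[OF n2 F assms] by (simp add: live_def)
  also have "\<dots> \<longleftrightarrow> \<not> C \<subseteq> X \<or> (\<forall>j\<in>{1..n}. \<not> D j \<subseteq> X)"
  proof
    assume "\<exists>w\<in>common_nbrs n m {f, g}. w ` {1..n} \<inter> X = {}"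
    then obtain w where w: "w \<in> common_nbrs n m {f, g}" "w ` {1..n} \<inter> X = {}" by blast
    have "w \<in> verts n m" using w(1) by (simp add: common_nbrs_def)
    then consider y where "y \<in> {1..m}" "w = const_map n y" | "w \<in> inj_maps n m"
      by (auto simp: verts_def)
    then show "\<not> C \<subseteq> X \<or> (\<forall>j\<in>{1..n}. \<not> D j \<subseteq> X)"
    proof cases
      case (1 y)
      have im: "w ` {1..n} = {y}" using 1 n2 by (force simp: const_map_def)
      have "y \<notin> f ` {1..n}" "y \<notin> g ` {1..n}"
      proof -
        have nbr: "adj n f w" "adj n g w" using w(1) by (simp_all add: common_nbrs_def)
        have "h i \<noteq> y" if h: "adj n h w" and i: "i \<in> {1..n}" for h i
        proof -
          define j where "j = (if i = 1 then 2 else 1 :: nat)"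
          have "j \<in> {1..n}" "i \<noteq> j" using n2 by (auto simp: j_def)
          with h i have "h i \<noteq> w j" unfolding adj_def by blast
          then show ?thesis using 1 \<open>j \<in> {1..n}\<close> by (simp add: const_map_def)
        qed
        with nbr show "y \<notin> f ` {1..n}" "y \<notin> g ` {1..n}" by blast+
      qed
      then have "y \<in> C" using 1 by (auto simp: C_def D_def)
      moreover have "y \<notin> X" using w(2) im by auto
      ultimately show ?thesis by blast
    next
      case 2
      show ?thesis
      proof (rule disj_imp[THEN iffD2], rule impI)
        assume "\<not> \<not> C \<subseteq> X"
        then show "\<forall>j\<in>{1..n}. \<not> D j \<subseteq> X"
          using common_nbr_inj[OF 2 w(1)] w(2) by blast
      qed
    qed
  next
    assume "\<not> C \<subseteq> X \<or> (\<forall>j\<in>{1..n}. \<not> D j \<subseteq> X)"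
    then show "\<exists>w\<in>common_nbrs n m {f, g}. w ` {1..n} \<inter> X = {}"
    proof
      assume "\<not> C \<subseteq> X"
      then obtain y where y: "y \<in> C" "y \<notin> X" by blast
      have "const_map n y \<in> verts n m" using y(1) C_subset by (auto simp: verts_def)
      moreover have "adj n f (const_map n y)" "adj n g (const_map n y)"
        using y(1) by (auto simp: adj_def const_map_def C_def D_def)
      moreover have "const_map n y ` {1..n} \<inter> X = {}" using y(2) by (auto simp: const_map_def)
      ultimately show ?thesis by (auto simp: common_nbrs_def)
    next
      assume "\<forall>j\<in>{1..n}. \<not> D j \<subseteq> X"
      then have "\<forall>j\<in>{1..n}. \<exists>x. x \<in> D j \<and> x \<notin> X" by blast
      then obtain h where h: "\<And>j. j \<in> {1..n} \<Longrightarrow> h j \<in> D j \<and> h j \<notin> X" by metis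
      let ?w = "restrict h {1..n}"
      have "?w \<in> {1..n} \<rightarrow>\<^sub>E {1..m}" using h D_subset by (simp add: subset_iff)
      moreover have "inj_on ?w {1..n}"
        using h D_disjoint by (intro inj_onI) (metis restrict_apply')
      ultimately have "?w \<in> common_nbrs n m {f, g}" using h by (intro common_nbrI) auto
      moreover have "?w ` {1..n} \<inter> X = {}" using h by auto
      ultimately show ?thesis by blast
    qed
  qed
  finally show ?thesis .
qed

section \<open>What the successive stages leave over\<close>

lemma live_1_iff:
  assumes X: "X \<subseteq> {1..m}"
  shows "live n m {f, g} 1 X \<longleftrightarrow>
    live n m {f, g} 0 X \<and> 1 \<notin> X \<and> C - {1} \<subseteq> X \<and> (\<exists>j\<in>{1..n}. D j \<subseteq> insert 1 X)"
proof -
  have 1: "1 \<in> {1..m}" using a_range by simp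
  show ?thesis
  proof (cases "1 \<in> X")
    \<comment> \<open>A live set containing 1 stays live when 1 is removed, so the first stage
      matches it.\<close>
    case True
    have "X - {1} \<subseteq> {1..m}" using X by blast
    with True show ?thesis
      using live_Suc_iff[OF n2 F, of 0 X] live_0_iff[OF X] live_0_iff[of "X - {1}"]
      by (auto simp: toggle_def)
  next
    case False
    have "insert 1 X \<subseteq> {1..m}" using X 1 by blast
    with False show ?thesis
      using live_Suc_iff[OF n2 F, of 0 X] live_0_iff[of "insert 1 X"]
      by (auto simp: toggle_def)
  qed
qed

text \<open>All numbers below the minimum \<open>a\<close> lie in \<open>C\<close>. After the first
  stage, those other than 1 are forced into every remaining set, so toggling them gives no partner
  and the stages strictly between 1 and \<open>a\<close> match nothing.\<close>

lemma live_before: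
  assumes "1 \<le> i" "i < a" "X \<subseteq> {1..m}"
  shows "live n m {f, g} i X \<longleftrightarrow> 1 \<notin> X \<and> C - {1} \<subseteq> X \<and> (\<exists>j\<in>{1..n}. D j \<subseteq> X)"
  using assms
proof (induction i arbitrary: X rule: dec_induct)
  case base
  have C1: "1 \<in> C"
  proof (rule C_D_cases[of 1])
    show "1 \<in> {1..m}" using a_range by simp
  next
    fix j assume "j \<in> {1..n}" "1 \<in> D j"
    with a_le_D base show "1 \<in> C" by fastforce
  qed
  then have D1: "1 \<notin> D j" if "j \<in> {1..n}" for j using C_D_disjoint that by blast
  show ?case
    unfolding live_1_iff[OF base(2)] live_0_iff[OF base(2)] using C1 D1 by blast
next
  case (step i)
  have v: "Suc i \<in> C"
  proof (rule C_D_cases[of "Suc i"])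
    show "Suc i \<in> {1..m}" using step.prems a_range by simp
  next
    fix j assume "j \<in> {1..n}" "Suc i \<in> D j"
    with a_le_D step.prems(1) show "Suc i \<in> C" by fastforce
  qed
  have "toggle (Suc i) X \<subseteq> {1..m}" using step.prems(2) v C_subset by (intro toggle_subset) auto
  moreover have "Suc i \<noteq> 1" using step.hyps by simp
  ultimately show ?case
    using step v unfolding live_Suc_iff[OF n2 F] by (auto simp: toggle_def)
qed

lemma unmatched_Suc_iff:
  assumes "a \<le> i" "Suc i \<le> m" "X \<subseteq> {1..m}"
  shows "unmatched (Suc i) X \<longleftrightarrow> unmatched i X \<and> \<not> unmatched i (toggle (Suc i) X)"
proof -
  let ?v = "Suc i"
  have v: "?v \<in> {1..m}" "?v \<noteq> 1" using assms a_range by auto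
  have tX: "toggle ?v X \<subseteq> {1..m}" using v assms(3) by (intro toggle_subset)
  show ?thesis
  proof (cases "\<exists>j\<in>{1..n} - {k}. ?v \<in> D j \<and> (\<exists>d\<in>D j. d \<noteq> ?v \<and> low j = ?v)")
    \<comment> \<open>The stage treats the smaller element of a two-element \<open>D j\<close>.
      Toggling it is harmless unless it completes \<open>D j\<close>: sets without the larger
      element \<open>d\<close> are matched in pairs, those with \<open>d\<close> survive.\<close>
    case True
    then obtain j d where j: "j \<in> {1..n}" "j \<noteq> k" "?v \<in> D j" "d \<in> D j" "low j = ?v" "d \<noteq> ?v"
      by blast
    then have Dj: "D j = {?v, d}" by (auto simp: D_def)
    have other: "?v \<notin> D i" "low i \<noteq> ?v" if "i \<in> {1..n}" "i \<noteq> j" for i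
      using D_disjoint[of i j ?v] that j low_mem[of i] by auto
    have vCk: "?v \<notin> C" "?v \<notin> D k" using C_D_disjoint[OF j(1), of ?v] other[OF k] j by auto
    have tD: "D i \<subseteq> toggle ?v X \<longleftrightarrow> D i \<subseteq> X" "D i - {low i} \<subseteq> toggle ?v X \<longleftrightarrow> D i - {low i} \<subseteq> X"
      if "i \<in> {1..n}" "i \<noteq> j" for i
      using other[OF that] by (auto simp: toggle_def)
    have tC: "C \<union> D k - {1} \<subseteq> toggle ?v X \<longleftrightarrow> C \<union> D k - {1} \<subseteq> X"
      "1 \<in> toggle ?v X \<longleftrightarrow> 1 \<in> X" using vCk v by (auto simp: toggle_def)
    \<comment> \<open>\<open>R\<close> gathers the conditions that toggling \<open>?v\<close> does
      not affect, namely all except those on \<open>D j\<close>.\<close>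
    define R where "R Y \<longleftrightarrow> 1 \<notin> Y \<and> C \<union> D k - {1} \<subseteq> Y \<and>
       (\<forall>l\<in>{1..n} - {k} - {j}. \<not> D l \<subseteq> Y \<and> (low l \<le> i \<longrightarrow> D l - {low l} \<subseteq> Y))" for Y
    have split_j: "(\<forall>l\<in>{1..n} - {k}. P l) \<longleftrightarrow> P j \<and> (\<forall>l\<in>{1..n} - {k} - {j}. P l)" for P
      using j by blast
    have Ri: "unmatched i Y \<longleftrightarrow> R Y \<and> \<not> D j \<subseteq> Y" if "Y \<subseteq> {1..m}" for Y
      using that j(5) Dj unfolding unmatched_def R_def split_j by auto
    have "low l \<le> Suc i \<longleftrightarrow> low l \<le> i" if "l \<in> {1..n} - {k} - {j}" for l
      using other[of l] that by auto
    then have RS: "unmatched (Suc i) X \<longleftrightarrow> R X \<and> \<not> D j \<subseteq> X \<and> d \<in> X"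
      using assms(3) j Dj unfolding unmatched_def R_def split_j by auto
    have Rt: "R (toggle ?v X) \<longleftrightarrow> R X" using tD tC by (auto simp: R_def)
    have "D j \<subseteq> toggle ?v X \<longleftrightarrow> ?v \<notin> X \<and> d \<in> X" using j(6) Dj by (auto simp: toggle_def)
    moreover have "D j \<subseteq> X \<longleftrightarrow> ?v \<in> X \<and> d \<in> X" using Dj by auto
    ultimately show ?thesis
      unfolding RS Ri[OF assms(3)] Ri[OF tX] Rt by blast
  next
    \<comment> \<open>Now membership of \<open>?v\<close> is forced. It must be present if it lies
      in \<open>C\<close> or \<open>D k\<close>, or is the larger element of a \<open>D j\<close>
      treated before; it must be absent if it is all of \<open>D j\<close>. Nothing is
      matched.\<close>
    case False
    have "unmatched (Suc i) X \<longleftrightarrow> unmatched i X"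
    proof -
      have "D j - {low j} \<subseteq> X" if "j \<in> {1..n} - {k}" "low j \<le> Suc i" "\<not> low j \<le> i" for j
      proof -
        have "low j = ?v" using that by simp
        with False that(1) low_mem[of j] have "D j = {?v}" by auto
        with \<open>low j = ?v\<close> show ?thesis by simp
      qed
      moreover have "low j \<le> i \<Longrightarrow> low j \<le> Suc i" for j by simp
      ultimately show ?thesis unfolding unmatched_def by blast
    qed
    moreover have "\<not> unmatched i (toggle ?v X)" if u: "unmatched i X"
    proof
      assume t: "unmatched i (toggle ?v X)"
      show False
      proof (rule C_D_cases[OF v(1)])
        assume "?v \<in> C"
        with u t v show False by (auto simp: unmatched_def toggle_def split: if_splits)
      next
        fix j assume j: "j \<in> {1..n}" "?v \<in> D j"
        show False
        proof (cases "j = k")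
          case True
          with j u t v show False by (auto simp: unmatched_def toggle_def split: if_splits)
        next
          case jk: False
          show False
          proof (cases "low j = ?v")
            case True
            with False j jk have "D j = {?v}" by blast
            moreover have "\<not> D j \<subseteq> X" "\<not> D j \<subseteq> toggle ?v X"
              using u t j(1) jk unfolding unmatched_def by blast+
            ultimately show False by (auto simp: toggle_def split: if_splits)
          next
            case False
            with low_le[OF j(2)] have "low j \<le> i" by simp
            then have "D j - {low j} \<subseteq> X" "D j - {low j} \<subseteq> toggle ?v X"
              using u t j(1) jk unfolding unmatched_def by blast+
            with j(2) False show False by (auto simp: toggle_def split: if_splits)
          qed
        qed
      qed
    qed
    ultimately show ?thesis by blast
  qed
qed

text \<open>The base is stage \<open>a\<close>. If \<open>a\<close> exceeds 1, a set is left over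
  before this stage only if it contains some \<open>D j\<close>, and toggling \<open>a\<close>
  affects \<open>D k\<close> alone. The survivors contain \<open>D k\<close> and no other
  \<open>D j\<close>. If \<open>a\<close> is 1, the first stage gives the same result.\<close>

lemma live_iff_unmatched:
  assumes "a \<le> i" "i \<le> m" "X \<subseteq> {1..m}"
  shows "live n m {f, g} i X \<longleftrightarrow> unmatched i X"
  using assms
proof (induction i arbitrary: X rule: dec_induct)
  case base
  \<comment> \<open>The other minima exceed \<open>a\<close>, so the last clause of
    \<open>unmatched\<close> is still vacuous.\<close>
  have low_a: "\<not> low j \<le> a" if "j \<in> {1..n}" "j \<noteq> k" for j
  proof -
    have "low j \<noteq> a" using D_disjoint[OF that(1) k, of a] low_mem[of j] a_mem that by metis
    with a_le_D[OF that(1) low_mem] show ?thesis by simp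
  qed
  have un: "unmatched a X \<longleftrightarrow> 1 \<notin> X \<and> C \<union> D k - {1} \<subseteq> X \<and> (\<forall>j\<in>{1..n} - {k}. \<not> D j \<subseteq> X)"
    using low_a base(2) by (auto simp: unmatched_def)
  show ?case
  proof (cases "a = 1")
    case True
    then have D1: "1 \<notin> D j" if "j \<in> {1..n}" "j \<noteq> k" for j
      using D_disjoint[OF that(1) k, of 1] a_mem that by auto
    have "1 \<in> D k" "1 \<notin> C" using True a_mem C_D_disjoint[OF k, of 1] by auto
    then show ?thesis
      unfolding un unfolding True live_1_iff[OF base(2)] live_0_iff[OF base(2)]
      using D1 k by blast
  next
    case False
    then obtain i where i: "a = Suc i" "1 \<le> i" using a_range by (cases a) auto
    have tX: "toggle a X \<subseteq> {1..m}" using base(2) a_range by (intro toggle_subset) auto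
    have aC: "a \<notin> C" using C_D_disjoint[OF k a_mem] .
    have aD: "a \<notin> D j" if "j \<in> {1..n}" "j \<noteq> k" for j
      using D_disjoint[OF that(1) k, of a] a_mem that by auto
    have "1 \<notin> D k" using a_le_D[OF k, of 1] a_range False by auto
    moreover have "live n m {f, g} a X \<longleftrightarrow>
        live n m {f, g} i X \<and> \<not> live n m {f, g} i (toggle a X)"
      unfolding i(1) by (rule live_Suc_iff[OF n2 F])
    moreover have split_k: "(\<exists>j\<in>{1..n}. D j \<subseteq> Y) \<longleftrightarrow>
        D k \<subseteq> Y \<or> (\<exists>j\<in>{1..n} - {k}. D j \<subseteq> Y)" for Y
      using k by blast
    have "live n m {f, g} i X \<longleftrightarrow>
        1 \<notin> X \<and> C - {1} \<subseteq> X \<and> (D k \<subseteq> X \<or> (\<exists>j\<in>{1..n} - {k}. D j \<subseteq> X))"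
      using live_before[of i X] i base(2) unfolding split_k by simp
    moreover have "live n m {f, g} i (toggle a X) \<longleftrightarrow>
        1 \<notin> X \<and> C - {1} \<subseteq> X \<and> (D k \<subseteq> toggle a X \<or> (\<exists>j\<in>{1..n} - {k}. D j \<subseteq> X))"
    proof -
      have "D j \<subseteq> toggle a X \<longleftrightarrow> D j \<subseteq> X" if "j \<in> {1..n} - {k}" for j
        using aD[of j] that by (auto simp: toggle_def)
      moreover have "C - {1} \<subseteq> toggle a X \<longleftrightarrow> C - {1} \<subseteq> X" "1 \<in> toggle a X \<longleftrightarrow> 1 \<in> X"
        using aC False by (auto simp: toggle_def)
      ultimately show ?thesis
        using live_before[of i "toggle a X"] i tX unfolding split_k by simp
    qed
    moreover have "D k \<subseteq> X \<Longrightarrow> \<not> D k \<subseteq> toggle a X"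
      using a_mem by (auto simp: toggle_def)
    ultimately show ?thesis unfolding un by blast
  qed
next
  case (step i)
  have "toggle (Suc i) X \<subseteq> {1..m}" using step.prems by (intro toggle_subset) auto
  with step show ?case
    unfolding live_Suc_iff[OF n2 F] by (simp add: unmatched_Suc_iff)
qed

end

section \<open>Continuing a path from a chosen facet\<close>

definition leads ::
  "nat \<Rightarrow> nat \<Rightarrow> (nat \<Rightarrow> nat) set \<Rightarrow> (nat \<Rightarrow> nat) set list \<Rightarrow> (nat \<Rightarrow> nat) set \<Rightarrow> bool" where
  "leads n m y ys \<alpha> \<longleftrightarrow>
     ys = [] \<and> y = \<alpha> \<or> (\<exists>zs. ys = y # zs \<and> y \<in> S n m \<and> path_from n m y (mu n m y) zs \<alpha>)"

text \<open>\<open>leads\<close> treats the end of a path and a further matching step alike. For the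
  end, being different from \<open>q\<close> is automatic: a critical cell is not in
  \<open>S\<close>, and a covered cell differs from the one covering it.\<close>

lemma path_from_iff_leads:
  assumes "critical n m \<alpha>" "q \<in> S n m \<or> q = \<tau>"
  shows "path_from n m q \<tau> ys \<alpha> \<longleftrightarrow> (\<exists>y. covers \<tau> y \<and> y \<noteq> q \<and> leads n m y ys \<alpha>)"
proof (cases ys)
  case Nil
  have "covers \<tau> \<alpha> \<Longrightarrow> \<alpha> \<noteq> q" using assms S_not_critical covers_neq by blast
  with Nil show ?thesis by (auto simp: leads_def)
next
  case (Cons y zs)
  then show ?thesis by (auto simp: leads_def)
qed

lemma not_leads_const_1:
  assumes "1 \<le> m" "\<tau> \<in> nbhd_complex n m" "const_map n 1 \<in> \<tau>" "\<tau> \<noteq> {const_map n 1}"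
    and "critical n m \<alpha>"
  shows "\<not> leads n m \<tau> ys \<alpha>"
  using const_1_dead[OF assms(1-4)] assms(5) by (auto simp: leads_def)

lemma not_leads_pairable_1:
  assumes "1 \<le> m" "finite y" "1 < card y" "const_map n 1 \<notin> y"
    and "insert (const_map n 1) y \<in> nbhd_complex n m" and "critical n m \<alpha>"
  shows "\<not> leads n m y ys \<alpha>"
  using no_path_through[OF assms] assms(6) by (auto simp: leads_def)

lemma leads_critical_iff:
  "critical n m y \<Longrightarrow> leads n m y ys \<alpha> \<longleftrightarrow> ys = [] \<and> y = \<alpha>"
  using S_not_critical by (auto simp: leads_def)

lemma covers_cell_iff:
  assumes "2 \<le> n" "F \<subseteq> inj_maps n m" "finite X" "finite F"
  shows "covers (cell n X F) y \<longleftrightarrow>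
    (\<exists>x\<in>X. y = cell n (X - {x}) F) \<or> (\<exists>h\<in>F. y = cell n X (F - {h}))"
proof -
  have fin: "finite (cell n X F)" using assms by (simp add: cell_def)
  have "(\<exists>v\<in>cell n X F. y = cell n X F - {v}) \<longleftrightarrow>
    (\<exists>x\<in>X. y = cell n X F - {const_map n x}) \<or> (\<exists>h\<in>F. y = cell n X F - {h})"
    by (auto simp: cell_def)
  moreover have "cell n X F - {h} = cell n X (F - {h})" if "h \<in> F" for h
    using cell_remove_map[OF assms(1)] that assms(2) by blast
  ultimately show ?thesis
    unfolding covers_iff[OF fin] by (simp add: cell_remove[OF assms(1,2)])
qed

section \<open>The critical set, and complements of transversals\<close>

context adjacent_pair
begin

definition compl :: "(nat \<Rightarrow> nat) \<Rightarrow> nat set" where "compl z = {1..m} - z ` {1..n}"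

definition lowest :: "nat \<Rightarrow> nat" where "lowest = (\<lambda>j. if j = k then 1 else low j)"

lemma compl_subset: "compl z \<subseteq> {1..m}" "finite (compl z)" by (auto simp: compl_def)

lemma mem_compl_iff:
  assumes "z k = 1"
  shows "x \<in> compl z \<longleftrightarrow> x \<in> {1..m} \<and> x \<noteq> 1 \<and> (\<forall>j\<in>{1..n} - {k}. x \<noteq> z j)"
proof -
  have "z ` {1..n} = insert 1 (z ` ({1..n} - {k}))"
    using k assms by (metis image_insert insert_Diff)
  then show ?thesis unfolding compl_def by blast
qed

lemma mem_compl_lowest_iff:
  "x \<in> compl lowest \<longleftrightarrow> x \<in> {1..m} \<and> x \<noteq> 1 \<and> (\<forall>j\<in>{1..n} - {k}. x \<noteq> low j)"
  using mem_compl_iff[of lowest x] by (simp add: lowest_def)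

lemma one_notin_D: "\<lbrakk>j \<in> {1..n}; j \<noteq> k\<rbrakk> \<Longrightarrow> 1 \<notin> D j"
  using a_le_D[of j 1] a_mem a_range D_disjoint[OF _ k, of j 1] by fastforce

lemma a_less_low: "\<lbrakk>j \<in> {1..n}; j \<noteq> k\<rbrakk> \<Longrightarrow> a < low j"
  using a_le_D[OF _ low_mem, of j] D_disjoint[OF _ k, of j a] low_mem[of j] a_mem
  by (metis le_neq_implies_less)

lemma low_le_m: "j \<in> {1..n} \<Longrightarrow> low j \<le> m"
  using D_subset low_mem by fastforce

text \<open>After stage m every minimum has been treated, so each \<open>D j\<close> with j other
  than k misses exactly its minimum. Together with the clauses on 1, \<open>C\<close> and
  \<open>D k\<close> this decides every membership.\<close>

lemma unmatched_m_iff: "unmatched m X \<longleftrightarrow> X = compl lowest"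
proof
  assume u: "unmatched m X"
  have low: "low j \<notin> X \<and> D j - {low j} \<subseteq> X" if "j \<in> {1..n}" "j \<noteq> k" for j
    using u low_le_m[of j] that unfolding unmatched_def by blast
  show "X = compl lowest"
  proof (intro set_eqI iffI)
    fix x assume "x \<in> X"
    with u have "x \<in> {1..m}" "x \<noteq> 1" by (auto simp: unmatched_def)
    with low \<open>x \<in> X\<close> show "x \<in> compl lowest" unfolding mem_compl_lowest_iff by blast
  next
    fix x assume x: "x \<in> compl lowest"
    then have x1: "x \<in> {1..m}" "x \<noteq> 1" "\<And>j. \<lbrakk>j \<in> {1..n}; j \<noteq> k\<rbrakk> \<Longrightarrow> x \<noteq> low j"
      unfolding mem_compl_lowest_iff by blast+
    from x1(1) show "x \<in> X"
    proof (rule C_D_cases)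
      assume "x \<in> C" with x1 u show ?thesis unfolding unmatched_def by blast
    next
      fix j assume j: "j \<in> {1..n}" "x \<in> D j"
      show ?thesis
      proof (cases "j = k")
        case True
        with x1 j u show ?thesis unfolding unmatched_def by blast
      next
        case False
        with x1(3) low j show ?thesis by blast
      qed
    qed
  qed
next
  assume X: "X = compl lowest"
  have "C \<union> D k - {1} \<subseteq> X"
  proof
    fix x assume x: "x \<in> C \<union> D k - {1}"
    have "x \<noteq> low j" if "j \<in> {1..n}" "j \<noteq> k" for j
      using x that low_mem[of j] C_D_disjoint[of j x] D_disjoint[OF _ k, of j x] by blast
    moreover have "x \<in> {1..m}" using x C_subset D_subset[OF k] by blast
    ultimately show "x \<in> X" using x unfolding X mem_compl_lowest_iff by blast
  qed
  moreover have "low j \<notin> X" if "j \<in> {1..n}" "j \<noteq> k" for j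
    using that unfolding X mem_compl_lowest_iff by blast
  moreover have "D j - {low j} \<subseteq> X" if j: "j \<in> {1..n}" "j \<noteq> k" for j
  proof
    fix x assume x: "x \<in> D j - {low j}"
    have "x \<noteq> low i" if "i \<in> {1..n}" for i
      using x low_mem[of i] D_disjoint[OF j(1) that, of x] by blast
    moreover have "x \<noteq> 1" "x \<in> {1..m}" using x one_notin_D[OF j] D_subset[OF j(1)] by blast+
    ultimately show "x \<in> X" unfolding X mem_compl_lowest_iff by blast
  qed
  moreover have "1 \<notin> X" unfolding X mem_compl_lowest_iff by blast
  ultimately show "unmatched m X"
    using low_mem compl_subset unfolding unmatched_def X by blast
qed

lemma critical_cell_iff:
  assumes "X \<subseteq> {1..m}"
  shows "critical n m (cell n X {f, g}) \<longleftrightarrow> X = compl lowest"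
  using live_iff_unmatched[OF a_range(2) order_refl assms]
  by (simp add: critical_iff_rest live_def unmatched_m_iff)

lemma up_step:
  assumes "a \<le> i" "i < m" "Suc i \<notin> X" "unmatched i X" "unmatched i (insert (Suc i) X)"
  shows "cell n X {f, g} \<in> S n m" "mu n m (cell n X {f, g}) = cell n (insert (Suc i) X) {f, g}"
proof -
  have live: "live n m {f, g} i Y \<longleftrightarrow> unmatched i Y" if "unmatched i Y" for Y
    using that assms(1,2) live_iff_unmatched[of i Y] by (simp add: unmatched_def)
  have "cell n X {f, g} \<in> rest n m i" "insert (const_map n (Suc i)) (cell n X {f, g}) \<in> rest n m i"
    using live[OF assms(4)] live[OF assms(5)] assms(4,5) by (simp_all add: live_def cell_insert)
  then show "cell n X {f, g} \<in> S n m"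
    "mu n m (cell n X {f, g}) = cell n (insert (Suc i) X) {f, g}"
    using matched_up[OF assms(2), of "cell n X {f, g}" n] mem_cell_const_map[OF n2 F, of "Suc i" X]
      assms(3) by (simp_all add: cell_insert)
qed

lemma down_step:
  assumes "a \<le> i" "i < m" "Suc i \<in> X" "unmatched i X" "unmatched i (X - {Suc i})" "critical n m \<alpha>"
  shows "\<not> leads n m (cell n X {f, g}) ys \<alpha>"
proof -
  have live: "live n m {f, g} i Y \<longleftrightarrow> unmatched i Y" if "unmatched i Y" for Y
    using that assms(1,2) live_iff_unmatched[of i Y] by (simp add: unmatched_def)
  have "cell n X {f, g} \<in> rest n m i" "cell n X {f, g} - {const_map n (Suc i)} \<in> rest n m i"
    using live[OF assms(4)] live[OF assms(5)] assms(4,5)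
    by (simp_all add: live_def cell_remove[OF n2 F])
  then have "cell n X {f, g} \<notin> S n m" "\<not> critical n m (cell n X {f, g})"
    using matched_down[OF assms(2), of "cell n X {f, g}" n] mem_cell_const_map[OF n2 F, of "Suc i" X]
      assms(3) by simp_all
  with assms(6) show ?thesis by (auto simp: leads_def)
qed

text \<open>The alternative in the hypothesis provides a second element of the cell, which
  \<open>not_leads_pairable_1\<close> requires.\<close>

lemma dead_cell:
  assumes X: "X \<subseteq> {1..m}" "X \<noteq> {} \<or> f \<noteq> g" "1 \<notin> X"
    and P: "live n m {f, g} 0 (insert 1 X)"
    and \<alpha>: "critical n m \<alpha>"
  shows "\<not> leads n m (cell n X {f, g}) ys \<alpha>"
proof (rule not_leads_pairable_1[OF _ _ _ _ _ \<alpha>])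
  have fin: "finite X" using X(1) finite_subset by blast
  show "finite (cell n X {f, g})" using fin by (simp add: cell_def)
  have "0 < card X \<or> f \<noteq> g" using fin X(2) by (auto simp: card_gt_0_iff)
  then show "1 < card (cell n X {f, g})"
    using card_cell[OF n2 F fin] by (cases "f = g") auto
  show "const_map n 1 \<notin> cell n X {f, g}" using X(3) mem_cell_const_map[OF n2 F] by blast
  show "insert (const_map n 1) (cell n X {f, g}) \<in> nbhd_complex n m"
    using P by (simp add: live_def cell_insert)
  show "1 \<le> m" using a_range by simp
qed

definition transversal :: "(nat \<Rightarrow> nat) \<Rightarrow> bool" where
  "transversal z \<longleftrightarrow> z k = 1 \<and> (\<forall>j\<in>{1..n} - {k}. z j \<in> D j)"

lemma transversal_lowest: "transversal lowest"
  by (simp add: transversal_def lowest_def low_mem)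

lemma transversal_subset:
  assumes "transversal z" shows "z ` {1..n} \<subseteq> {1..m}"
proof (rule image_subsetI)
  fix j assume "j \<in> {1..n}"
  then show "z j \<in> {1..m}"
    using assms D_subset[of j] a_range unfolding transversal_def
    by (cases "j = k") (simp, blast)
qed

lemma transversal_inj:
  assumes "transversal z" shows "inj_on z {1..n}"
proof (rule inj_onI)
  fix i j assume ij: "i \<in> {1..n}" "j \<in> {1..n}" and eq: "z i = z j"
  have one: "l = k" if "l \<in> {1..n}" "z l = 1" for l
    using assms that one_notin_D[of l] unfolding transversal_def by (metis DiffI singletonD)
  show "i = j"
  proof (cases "i = k \<or> j = k")
    case True
    then have "z i = 1" "z j = 1" using assms eq by (auto simp: transversal_def)
    with one ij show ?thesis by metis
  next
    case False
    with assms ij have "z i \<in> D i" "z j \<in> D j" by (auto simp: transversal_def)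
    with D_disjoint[OF ij] eq show ?thesis by simp
  qed
qed

lemma card_compl: "transversal z \<Longrightarrow> card (compl z) = m - n"
  using transversal_subset card_image[OF transversal_inj] unfolding compl_def
  by (simp add: card_Diff_subset)

end

section \<open>Paths over a single map\<close>

text \<open>With f = g = h every \<open>D j\<close> is a single point. If \<open>X\<close> has p
  elements, avoids 1 and contains \<open>C - {1}\<close>, it is the critical set or arises from it
  by exchanging one element; in the latter case one matching step, adding the least value
  \<open>h k\<close>, repairs it. All other \<open>X\<close> of this size are stopped by the first
  stage. \<open>t X\<close> is the only continuation.\<close>

lemma leads_single_map:
  assumes "3 \<le> n" and m: "m = n + p" and p: "1 \<le> p" and h: "h \<in> inj_maps n m"
  obtains Y t where "Y \<subseteq> {1..m}" "card Y = p" "critical n m (cell n Y {h})"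
    and "\<And>X ys \<alpha>. \<lbrakk>X \<subseteq> {1..m}; card X = p; critical n m \<alpha>\<rbrakk> \<Longrightarrow>
      leads n m (cell n X {h}) ys \<alpha> \<longleftrightarrow>
      1 \<notin> X \<and> {1..m} - h ` {1..n} - {1} \<subseteq> X \<and> \<alpha> = cell n Y {h} \<and> ys = t X"
proof -
  have n2: "2 \<le> n" using assms(1) by simp
  have ne: "finite (h ` {1..n})" "h ` {1..n} \<noteq> {}" using n2 by auto
  obtain k where k: "k \<in> {1..n}" "h k = Min (h ` {1..n})" using Min_in[OF ne] by auto
  interpret adjacent_pair n m k "h k" h h
  proof
    show "adj n h h" using inj_onD[OF inj_mapsD(2)[OF h]] by (auto simp: adj_def)
  qed (use n2 h k ne in auto)
  have hh: "{h, h} = {h}" by simp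
  have D_h: "D j = {h j}" for j by (simp add: D_def)
  have C_h: "C = {1..m} - h ` {1..n}" by (auto simp: C_def D_h)
  have card_C: "card C = p"
    using inj_mapsD(3,4)[OF h] m unfolding C_h by (simp add: card_Diff_subset)
  have fin_C: "finite C" using C_subset finite_subset by blast
  let ?Y = "compl lowest"
  have u: "unmatched m ?Y" by (simp add: unmatched_m_iff)
  then have CY: "C \<union> {h k} - {1} \<subseteq> ?Y" by (simp add: unmatched_def D_h)
  have low_h: "low j = h j" for j by (simp add: low_def)
  have card_Y: "card ?Y = p" using card_compl[OF transversal_lowest] m by simp
  have crit_Y: "critical n m (cell n ?Y {h})"
    using critical_cell_iff[OF compl_subset(1)] by simp
  have no_leads: "\<not> leads n m (cell n X {h}) ys \<alpha>"
    if X: "X \<subseteq> {1..m}" "card X = p" and \<alpha>: "critical n m \<alpha>" and "1 \<in> X \<or> \<not> C - {1} \<subseteq> X"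
    for X ys \<alpha>
  proof (cases "1 \<in> X")
    case True
    have finX: "finite X" using X(1) finite_subset by blast
    \<comment> \<open>\<open>X\<close> and \<open>C\<close> have equal size, so \<open>X\<close>
      misses a point of \<open>C\<close> or equals \<open>C\<close>; in the second case it contains
      no value of h.\<close>
    have "\<not> C \<subseteq> X \<or> X = C" using card_subset_eq[OF finX, of C] card_C X(2) by auto
    then have "live n m {h} 0 X"
      using live_0_iff[OF X(1)] C_D_disjoint unfolding hh D_h by blast
    moreover have "const_map n 1 \<in> cell n X {h}" using True by (simp add: cell_def)
    moreover have "h \<noteq> const_map n 1" using const_map_notin_inj_maps[OF n2, of 1 m] h by auto
    then have "cell n X {h} \<noteq> {const_map n 1}" by (auto simp: cell_def)
    ultimately show ?thesis
      using not_leads_const_1[OF _ _ _ _ \<alpha>] a_range by (simp add: live_def)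
  next
    case False
    with that have nC: "\<not> C - {1} \<subseteq> X" by blast
    have "insert 1 X \<subseteq> {1..m}" using X(1) a_range by auto
    then have "live n m {h, h} 0 (insert 1 X)" using live_0_iff nC by blast
    moreover have "X \<noteq> {} \<or> h \<noteq> h" using X(2) p by auto
    ultimately show ?thesis using dead_cell[OF X(1) _ False _ \<alpha>] unfolding hh by blast
  qed
  define t where "t X = (if X = ?Y then [] else [cell n X {h}])" for X
  show thesis
  proof (rule that[of ?Y t])
    show "?Y \<subseteq> {1..m}" by (rule compl_subset)
    show "card ?Y = p" by (rule card_Y)
    show "critical n m (cell n ?Y {h})" by (rule crit_Y)
    fix X ys \<alpha>
    assume X: "X \<subseteq> {1..m}" "card X = p" and \<alpha>: "critical n m \<alpha>"
    have finX: "finite X" using X(1) finite_subset by blast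
    show "leads n m (cell n X {h}) ys \<alpha> \<longleftrightarrow>
        1 \<notin> X \<and> {1..m} - h ` {1..n} - {1} \<subseteq> X \<and> \<alpha> = cell n ?Y {h} \<and> ys = t X"
    proof (cases "1 \<in> X \<or> \<not> C - {1} \<subseteq> X")
      case True
      with no_leads[OF X \<alpha>] show ?thesis unfolding C_h by blast
    next
      case ok: False
      show ?thesis
      proof (cases "X = ?Y")
        case True
        with ok crit_Y show ?thesis
          unfolding C_h t_def by (auto simp: leads_critical_iff)
      next
        case False
        \<comment> \<open>If 1 were not in \<open>C\<close>, counting would make both
          \<open>X\<close> and the critical set equal to \<open>C\<close>.\<close>
        have C1: "1 \<in> C"
        proof (rule ccontr)
          assume "1 \<notin> C"
          then have "C \<subseteq> X" "C \<subseteq> ?Y" using ok CY by blast+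
          then have "C = X" "C = ?Y"
            using card_subset_eq[OF finX] card_subset_eq[OF compl_subset(2)] card_C card_Y X(2)
            by metis+
          with False show False by simp
        qed
        then have hk: "1 < h k"
          using C_D_disjoint[OF k(1) a_mem] a_range(1) by (metis le_neq_implies_less)
        then obtain i where i: "h k = Suc i" "1 \<le> i" by (cases "h k") auto
        \<comment> \<open>The set \<open>C - {1}\<close> together with \<open>h k\<close> already
          has p elements.\<close>
        have Y_eq: "Z = ?Y" if "C - {1} \<subseteq> Z" "h k \<in> Z" "finite Z" "card Z = p" for Z
        proof -
          have "h k \<notin> C" using C_D_disjoint[OF k(1) a_mem] .
          then have "card (insert (h k) (C - {1})) = p"
            using C1 fin_C card_C p by simp
          moreover have "insert (h k) (C - {1}) \<subseteq> Z" "insert (h k) (C - {1}) \<subseteq> ?Y"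
            using that CY hk by auto
          ultimately show ?thesis
            using card_subset_eq[OF that(3)] card_subset_eq[OF compl_subset(2)] card_Y that(4)
            by metis
        qed
        have hkX: "h k \<notin> X" using Y_eq[of X] ok False finX X(2) by blast
        \<comment> \<open>\<open>C - {1}\<close> has only p - 1 elements, so \<open>X\<close>
          contains some value of h. This full \<open>D j\<close> keeps \<open>X\<close> live through
          stage \<open>h k\<close> - 1.\<close>
        have "\<not> X \<subseteq> C - {1}"
        proof
          assume "X \<subseteq> C - {1}"
          then have "card X \<le> card (C - {1})" using fin_C by (intro card_mono) auto
          then show False using C1 card_C X(2) p by simp
        qed
        then obtain x where x: "x \<in> X" "x \<notin> C" using ok by blast
        then obtain j where j: "j \<in> {1..n}" "h j = x" using X(1) unfolding C_h by blast
        have insX: "insert (h k) X \<subseteq> {1..m}" using X(1) a_range by auto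
        have "live n m {h, h} i X" "live n m {h, h} i (insert (h k) X)"
          using live_before[of i X] live_before[of i "insert (h k) X"] i ok X(1) insX hk j x
          unfolding D_h by auto
        then have "cell n X {h} \<in> rest n m i"
          "insert (const_map n (Suc i)) (cell n X {h}) \<in> rest n m i"
          using i(1) by (simp_all add: live_def cell_insert)
        moreover have "const_map n (Suc i) \<notin> cell n X {h}"
          using mem_cell_const_map[OF n2, of "{h}"] h hkX i by simp
        moreover have "i < m" using i a_range by simp
        ultimately have up: "cell n X {h} \<in> S n m"
          "mu n m (cell n X {h}) = cell n (insert (h k) X) {h}"
          using matched_up[of i m "cell n X {h}" n] i by (simp_all add: cell_insert)
        have facet: "leads n m \<tau> zs \<alpha> \<longleftrightarrow> \<tau> = cell n ?Y {h} \<and> zs = [] \<and> \<alpha> = cell n ?Y {h}"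
          if cov: "covers (cell n (insert (h k) X) {h}) \<tau>" and neq: "\<tau> \<noteq> cell n X {h}" for \<tau> zs
        proof -
          have "(\<exists>x\<in>insert (h k) X. \<tau> = cell n (insert (h k) X - {x}) {h}) \<or>
              \<tau> = cell n (insert (h k) X) {}"
            using cov covers_cell_iff[OF n2, of "{h}" m "insert (h k) X" \<tau>] h finX by simp
          then show ?thesis
          proof (elim disjE bexE)
            assume \<tau>: "\<tau> = cell n (insert (h k) X) {}"
            have "\<not> leads n m \<tau> zs \<alpha>"
            proof (rule not_leads_pairable_1[OF _ _ _ _ _ \<alpha>])
              show "1 \<le> m" using m p by simp
              show "finite \<tau>" using finX \<tau> by (simp add: cell_def)
              show "1 < card \<tau>"
                using card_cell[OF n2, of "{}" m "insert (h k) X"] finX hkX X(2) p \<tau> by simp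
              show "const_map n 1 \<notin> \<tau>"
                using mem_cell_const_map[OF n2, of "{}" m 1 "insert (h k) X"] \<tau> ok hk by simp
              \<comment> \<open>Here \<open>3 \<le> n\<close> enters: p + 2 constants do not exhaust
                \<open>{1..m}\<close>, so some constant map remains as a common neighbour.\<close>
              have c: "card (insert 1 (insert (h k) X)) < card {1..m}"
                using finX hkX X(2) ok hk m assms(1) by simp
              have sub: "insert 1 (insert (h k) X) \<subseteq> {1..m}" using insX a_range by auto
              with c obtain y where y: "y \<in> {1..m}" "y \<notin> insert 1 (insert (h k) X)"
                by (metis less_irrefl subset_antisym subset_iff)
              have "const_map n y \<in> common_nbrs n m {}"
                using y(1) by (simp add: common_nbrs_def verts_def)
              moreover have "const_map n y ` {1..n} \<inter> insert 1 (insert (h k) X) = {}"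
                using y(2) by (auto simp: const_map_def)
              ultimately have "cell n (insert 1 (insert (h k) X)) {} \<in> nbhd_complex n m"
                using cell_in_nbhd_complex_iff[OF n2, of "{}" m "insert 1 (insert (h k) X)"] sub
                by blast
              then show "insert (const_map n 1) \<tau> \<in> nbhd_complex n m"
                using \<tau> by (simp add: cell_insert)
            qed
            moreover have "\<tau> \<noteq> cell n ?Y {h}"
              using cell_eq_iff[OF n2, of "{}" m "{h}"] h \<tau> by simp
            ultimately show ?thesis by simp
          next
            fix x assume x: "x \<in> insert (h k) X" and \<tau>: "\<tau> = cell n (insert (h k) X - {x}) {h}"
            let ?X = "insert (h k) X - {x}"
            have X': "?X \<subseteq> {1..m}" "card ?X = p" "finite ?X" "h k \<in> ?X"
              using insX finX hkX X(2) x neq \<tau> by (auto simp: card_insert_if)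
            show ?thesis
            proof (cases "C - {1} \<subseteq> ?X")
              case True
              then have "?X = ?Y" using Y_eq X' by blast
              then show ?thesis using crit_Y \<tau> by (auto simp: leads_critical_iff)
            next
              case False
              then have "?X \<noteq> ?Y" using CY by blast
              then have "\<tau> \<noteq> cell n ?Y {h}"
                using cell_eq_iff[OF n2, of "{h}" m "{h}"] h \<tau> by simp
              then show ?thesis using no_leads[OF X'(1,2) \<alpha>] False \<tau> by blast
            qed
          qed
        qed
        \<comment> \<open>By counting, \<open>X\<close> is \<open>C - {1}\<close> plus x, and
          exchanging x for \<open>h k\<close> gives the critical set.\<close>
        have cov: "covers (cell n (insert (h k) X) {h}) (cell n ?Y {h})"
        proof -
          have "insert x (C - {1}) = X"
            by (rule card_subset_eq[OF finX]) (use x ok C1 fin_C card_C X(2) p in auto)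
          then have "C - {1} \<subseteq> insert (h k) X - {x}" using x by blast
          moreover have "h k \<in> insert (h k) X - {x}" using x hkX by auto
          moreover have "card (insert (h k) X - {x}) = p" using finX x hkX X(2) by simp
          ultimately have "insert (h k) X - {x} = ?Y" using finX by (intro Y_eq) auto
          then show ?thesis
            using covers_cell_iff[OF n2, of "{h}" m "insert (h k) X"] h finX x by (metis empty_subsetI
              finite.emptyI finite_insert insertI2 insert_subset)
        qed
        have Ycell: "cell n ?Y {h} \<noteq> cell n X {h}"
          using cell_eq_iff[OF n2, of "{h}" m "{h}"] h False by simp
        have path: "path_from n m (cell n X {h}) (mu n m (cell n X {h})) zs \<alpha> \<longleftrightarrow>
            zs = [] \<and> \<alpha> = cell n ?Y {h}" for zs
          using path_from_iff_leads[OF \<alpha>, of "cell n X {h}"] up facet cov Ycell by metis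
        have "cell n X {h} \<noteq> \<alpha>" using S_not_critical up(1) \<alpha> by blast
        then show ?thesis
          using ok up(1) path False unfolding leads_def C_h[symmetric] t_def by auto
      qed
    qed
  qed
qed

section \<open>Paths over an adjacent pair\<close>

context adjacent_pair
begin

definition high :: "nat \<Rightarrow> nat" where "high j = max (f j) (g j)"

definition flips :: "(nat \<Rightarrow> nat) \<Rightarrow> nat set" where
  "flips z = {j \<in> {1..n} - {k}. z j \<noteq> low j}"

text \<open>The last clause imposes the decreasing order of minima; a one-element \<open>D l\<close>
  offers nothing to raise.\<close>

definition flippable :: "(nat \<Rightarrow> nat) \<Rightarrow> nat \<Rightarrow> bool" where
  "flippable z l \<longleftrightarrow> l \<in> {1..n} - {k} \<and> z l = low l \<and> low l \<noteq> high l \<and>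
     (\<forall>j\<in>flips z. low l < low j)"

text \<open>\<open>q\<close> is the cell from which the path moved up to the current one; at the start of the path it is a
  dummy, the current cell itself.\<close>

definition state :: "(nat \<Rightarrow> nat) \<Rightarrow> (nat \<Rightarrow> nat) set \<Rightarrow> bool" where
  "state z q \<longleftrightarrow> transversal z \<and>
     (flips z = {} \<and> q = cell n (compl z) {f, g} \<or>
      q \<in> S n m \<and> (\<exists>l\<in>flips z. (\<forall>j\<in>flips z. low l \<le> low j) \<and>
        q = cell n (compl z - {low l}) {f, g}))"

section \<open>Which facets let a path continue\<close>

lemma D_eq: "D j = {low j, high j}"
  by (auto simp: D_def low_def high_def min_def max_def)

lemma low_inj: "\<lbrakk>i \<in> {1..n}; j \<in> {1..n}; low i = low j\<rbrakk> \<Longrightarrow> i = j"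
  using D_disjoint low_mem by metis

lemma transversalD: "transversal z \<Longrightarrow> z k = 1"
  "\<lbrakk>transversal z; j \<in> {1..n} - {k}\<rbrakk> \<Longrightarrow> z j \<in> D j"
  by (simp_all add: transversal_def)

lemma mem_flipsD:
  assumes "j \<in> flips z" shows "j \<in> {1..n} - {k}" "z j \<noteq> low j"
  using assms by (simp_all add: flips_def)

text \<open>For j other than k, the only demand on \<open>D j\<close> before stage
  \<open>low j\<close> is that it is not contained in the set, and the omitted \<open>z j\<close>
  ensures this. Raised entries and deleted points with minimum above i thus go unnoticed by the
  first i stages.\<close>

lemma unmatched_diff:
  assumes z: "transversal z"
    and W: "\<And>x. x \<in> W \<Longrightarrow> \<exists>j\<in>{1..n} - {k}. x \<in> D j \<and> i < low j"
    and fl: "\<And>j. j \<in> flips z \<Longrightarrow> i < low j"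
  shows "unmatched i (compl z - W)"
proof -
  note mem = mem_compl_iff[of z, OF transversalD(1)[OF z]]
  have CD: "C \<union> D k - {1} \<subseteq> compl z - W"
  proof
    fix x assume x: "x \<in> C \<union> D k - {1}"
    have nD: "x \<notin> D j" if "j \<in> {1..n} - {k}" for j
      using x that C_D_disjoint[of j x] D_disjoint[OF _ k, of j x] by blast
    then have "x \<notin> W" using W by blast
    moreover have "x \<in> {1..m}" using x C_subset D_subset[OF k] by blast
    moreover have "x \<noteq> z j" if "j \<in> {1..n} - {k}" for j
      using transversalD(2)[OF z that] nD[OF that] by metis
    ultimately show "x \<in> compl z - W" using x mem by blast
  qed
  have "\<not> D j \<subseteq> compl z - W" if "j \<in> {1..n} - {k}" for j
    using transversalD(2)[OF z that] mem[of "z j"] that by blast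
  moreover have "D j - {low j} \<subseteq> compl z - W" if j: "j \<in> {1..n} - {k}" and le: "low j \<le> i" for j
  proof
    fix x assume x: "x \<in> D j - {low j}"
    have only: "i' = j" if "i' \<in> {1..n} - {k}" "x \<in> D i'" for i'
      using D_disjoint[of i' j x] that j x by blast
    then have "x \<notin> W" using W[of x] le by (metis not_less)
    moreover have "x \<noteq> z i'" if "i' \<in> {1..n} - {k}" for i'
    proof
      assume "x = z i'"
      then have "i' = j" using only that transversalD(2)[OF z that] by simp
      moreover have "z j = low j" using fl[of j] le j by (auto simp: flips_def)
      ultimately show False using x \<open>x = z i'\<close> by simp
    qed
    moreover have "x \<noteq> 1" using x one_notin_D[of j] j by blast
    moreover have "x \<in> {1..m}" using x D_subset[of j] j by blast
    ultimately show "x \<in> compl z - W" using mem by blast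
  qed
  ultimately show ?thesis
    using CD compl_subset(1)[of z] mem[of 1] unfolding unmatched_def by blast
qed

text \<open>With x gone the constant 1 can be added: either \<open>C\<close> is not contained in the
  set, or x is missing from \<open>D k\<close> and \<open>z j\<close> from every other
  \<open>D j\<close>.\<close>

lemma not_leads_remove_free:
  assumes z: "transversal z" and x: "x \<in> compl z" "x \<in> C \<union> D k" and "f \<noteq> g"
    and \<alpha>: "critical n m \<alpha>"
  shows "\<not> leads n m (cell n (compl z - {x}) {f, g}) ys \<alpha>"
proof (rule dead_cell[OF _ _ _ _ \<alpha>])
  note mem = mem_compl_iff[of z, OF transversalD(1)[OF z]]
  show "compl z - {x} \<subseteq> {1..m}" using compl_subset(1) by blast
  show "1 \<notin> compl z - {x}" using mem[of 1] by blast
  show "compl z - {x} \<noteq> {} \<or> f \<noteq> g" using assms(4) by blast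
  have x1: "x \<noteq> 1" using x(1) mem by blast
  let ?X = "insert 1 (compl z - {x})"
  have X: "?X \<subseteq> {1..m}" using compl_subset(1) a_range by auto
  have "\<not> C \<subseteq> ?X \<or> (\<forall>j\<in>{1..n}. \<not> D j \<subseteq> ?X)"
  proof (cases "x \<in> C")
    case True
    with x1 show ?thesis by blast
  next
    case False
    have "\<not> D j \<subseteq> ?X" if j: "j \<in> {1..n}" for j
    proof (cases "j = k")
      case True
      with False x(2) x1 show ?thesis by blast
    next
      case False
      then have "z j \<in> D j" "z j \<notin> compl z" "z j \<noteq> 1"
        using transversalD(2)[OF z, of j] mem[of "z j"] one_notin_D[OF j] j by auto
      then show ?thesis by blast
    qed
    then show ?thesis by blast
  qed
  then show "live n m {f, g} 0 ?X" using live_0_iff[OF X] by blast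
qed

lemma compl_flip:
  assumes z: "transversal z" and l: "l \<in> {1..n} - {k}" "z l = low l" "low l \<noteq> high l"
  shows "compl (z(l := high l)) = insert (low l) (compl z - {high l})"
    and "transversal (z(l := high l))" and "low l \<notin> compl z" and "high l \<in> compl z"
proof -
  note mem = mem_compl_iff[of z, OF transversalD(1)[OF z]]
  show tr: "transversal (z(l := high l))"
    using z l by (auto simp: transversal_def D_eq)
  note mem' = mem_compl_iff[of "z(l := high l)", OF transversalD(1)[OF tr]]
  show "low l \<notin> compl z" using mem[of "low l"] l by metis
  have Dl: "low l \<in> D l" "high l \<in> D l" by (simp_all add: D_eq)
  have range: "low l \<in> {1..m}" "high l \<in> {1..m}" "low l \<noteq> 1" "high l \<noteq> 1"
    using Dl D_subset[of l] one_notin_D[of l] l(1) by (blast, blast, metis DiffE singletonI, metis DiffE singletonI)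
  have other: "x \<noteq> z j" if "x \<in> D l" "j \<in> {1..n} - {k}" "j \<noteq> l" for x j
    using transversalD(2)[OF z that(2)] D_disjoint[of j l x] that l(1) by blast
  show "high l \<in> compl z"
  proof -
    have "high l \<noteq> z j" if "j \<in> {1..n} - {k}" for j
      using other[OF Dl(2) that] l by (cases "j = l") auto
    with range show ?thesis using mem by blast
  qed
  show "compl (z(l := high l)) = insert (low l) (compl z - {high l})"
  proof (intro set_eqI iffI)
    fix x assume x: "x \<in> compl (z(l := high l))"
    then have "x \<noteq> z j" if "j \<in> {1..n} - {k}" "j \<noteq> l" for j
      using mem'[of x] that by (metis fun_upd_apply)
    moreover have "x \<noteq> high l" using x mem'[of x] l(1) by (metis fun_upd_apply)
    moreover have "x \<in> {1..m}" "x \<noteq> 1" using x mem'[of x] by blast+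
    ultimately show "x \<in> insert (low l) (compl z - {high l})"
      using mem[of x] l(2) by (metis Diff_iff insert_iff singletonD)
  next
    fix x assume x: "x \<in> insert (low l) (compl z - {high l})"
    have "x \<noteq> (z(l := high l)) j" if j: "j \<in> {1..n} - {k}" for j
      using x other[OF Dl(1) j] mem[of x] j l(3) by (cases "j = l") auto
    moreover have "x \<in> {1..m} \<and> x \<noteq> 1"
      using x range mem[of x] by (cases "x = low l") auto
    ultimately show "x \<in> compl (z(l := high l))" using mem' by blast
  qed
qed

lemma flips_flip:
  assumes "l \<in> {1..n} - {k}" "low l \<noteq> high l"
  shows "flips (z(l := high l)) = insert l (flips z)"
  using assms by (auto simp: flips_def)

text \<open>A raise is one step down and one up: delete \<open>high l\<close>, then let stage
  \<open>low l\<close> add \<open>low l\<close>. Both cells reach this stage by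
  \<open>unmatched_diff\<close>, since all entries raised before have larger minima.\<close>

lemma flip_up:
  assumes z: "transversal z" and fl: "flippable z l"
  shows "cell n (compl z - {high l}) {f, g} \<in> S n m"
    and "mu n m (cell n (compl z - {high l}) {f, g}) = cell n (compl (z(l := high l))) {f, g}"
    and "state (z(l := high l)) (cell n (compl z - {high l}) {f, g})"
proof -
  have l: "l \<in> {1..n} - {k}" "z l = low l" "low l \<noteq> high l"
    and less: "\<And>j. j \<in> flips z \<Longrightarrow> low l < low j"
    using fl by (auto simp: flippable_def)
  note flip = compl_flip[OF z l]
  have al: "a < low l" using a_less_low[of l] l(1) by simp
  then obtain i where i: "low l = Suc i" "a \<le> i" by (cases "low l") auto
  have less': "i < low j" if "j \<in> flips z" for j using less[OF that] i by simp
  have "i < m" using low_le_m[of l] l(1) i(1) by simp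
  moreover have "Suc i \<notin> compl z - {high l}" using flip(3) i(1) by simp
  moreover have "unmatched i (compl z - {high l})"
    by (rule unmatched_diff[OF z]) (use less' i l(1) D_eq[of l] in \<open>auto intro!: bexI[of _ l]\<close>)
  moreover have "unmatched i (compl (z(l := high l)) - {})"
    by (rule unmatched_diff[OF flip(2)]) (use less' i in \<open>auto simp: flips_flip[OF l(1,3)]\<close>)
  then have "unmatched i (insert (Suc i) (compl z - {high l}))" using flip(1) i(1) by simp
  ultimately show up: "cell n (compl z - {high l}) {f, g} \<in> S n m"
    "mu n m (cell n (compl z - {high l}) {f, g}) = cell n (compl (z(l := high l))) {f, g}"
    using up_step[OF i(2)] flip(1) i(1) by simp_all
  have "compl (z(l := high l)) - {low l} = compl z - {high l}" using flip by auto
  moreover have "\<forall>j\<in>flips (z(l := high l)). low l \<le> low j"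
    unfolding flips_flip[OF l(1,3)] using less by (auto intro: less_imp_le)
  moreover have "l \<in> flips (z(l := high l))" unfolding flips_flip[OF l(1,3)] by simp
  ultimately show "state (z(l := high l)) (cell n (compl z - {high l}) {f, g})"
    unfolding state_def using up(1) flip(2) by metis
qed

text \<open>Stage \<open>low j\<close> comes before that of \<open>D l\<close>. It finds
  \<open>low j\<close> present and removable, so the cell is an upper partner and no path passes
  through it.\<close>

lemma not_leads_lower_flip:
  assumes z: "transversal z" and l: "l \<in> {1..n} - {k}" "x \<in> D l"
    and j: "j \<in> flips z" "low j < low l" "\<And>i. i \<in> flips z \<Longrightarrow> low j \<le> low i"
    and \<alpha>: "critical n m \<alpha>"
  shows "\<not> leads n m (cell n (compl z - {x}) {f, g}) ys \<alpha>"
proof -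
  have jk: "j \<in> {1..n} - {k}" "z j \<noteq> low j" using mem_flipsD[OF j(1)] .
  obtain i where i: "low j = Suc i" "a \<le> i"
    using a_less_low[of j] jk(1) by (cases "low j") auto
  have "low j \<noteq> x" using low_le[OF l(2)] j(2) by auto
  moreover have "low j \<in> compl z"
  proof -
    have "low j \<noteq> z i" if "i \<in> {1..n} - {k}" for i
      using transversalD(2)[OF z that] D_disjoint[of i j "low j"] low_mem[of j] jk that
      by (metis DiffD1)
    moreover have "low j \<noteq> 1" "low j \<in> {1..m}"
      using one_notin_D[of j] D_subset[of j] low_mem[of j] jk by (metis DiffE singletonI, blast)
    ultimately show ?thesis using mem_compl_iff[of z, OF transversalD(1)[OF z]] by blast
  qed
  ultimately have mem: "Suc i \<in> compl z - {x}" using i by simp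
  have "unmatched i (compl z - {x})"
    by (rule unmatched_diff[OF z]) (use l j i in \<open>fastforce\<close>)+
  moreover have "unmatched i (compl z - {x, low j})"
  proof (rule unmatched_diff[OF z])
    fix y assume "y \<in> {x, low j}"
    then show "\<exists>l\<in>{1..n} - {k}. y \<in> D l \<and> i < low l"
      using l j(2) jk(1) low_mem[of j] i by (metis Suc_lessD insertE lessI singletonD)
  qed (use j(3) i in force)
  moreover have "compl z - {x, low j} = compl z - {x} - {Suc i}" using i by auto
  moreover have "i < m" using low_le_m[of j] jk i by simp
  ultimately show ?thesis using down_step[OF i(2) _ mem _ _ \<alpha>] by metis
qed

text \<open>By the two preceding obstructions x lies in some \<open>D l\<close> such that no raised
  entry has a smaller minimum. If l itself were raised, x would be \<open>low l\<close> and its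
  removal would undo the last matching step. So l is not raised and x is
  \<open>high l\<close>.\<close>

lemma not_leads_or_flippable:
  assumes st: "state z q" and x: "x \<in> compl z" and fg: "f \<noteq> g" and \<alpha>: "critical n m \<alpha>"
    and neq: "cell n (compl z - {x}) {f, g} \<noteq> q"
    and leads: "leads n m (cell n (compl z - {x}) {f, g}) ys \<alpha>"
  obtains l where "flippable z l" "x = high l"
proof -
  have z: "transversal z" using st by (simp add: state_def)
  have "x \<in> {1..m}" using x compl_subset(1) by blast
  then obtain l where l: "l \<in> {1..n}" "x \<in> D l" "l \<noteq> k"
    using not_leads_remove_free[OF z x _ fg \<alpha>] leads by (elim C_D_cases) blast+
  have xz: "x \<noteq> z l" "z l \<in> D l"
    using x l mem_compl_iff[of z, OF transversalD(1)[OF z]] transversalD(2)[OF z, of l] by blast+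
  show thesis
  proof (cases "\<exists>j\<in>flips z. low j < low l")
    case True
    then have ne: "flips z \<noteq> {}" by blast
    have "finite (flips z)" by (simp add: flips_def)
    then obtain j where j: "j \<in> flips z" "\<And>i. i \<in> flips z \<Longrightarrow> low j \<le> low i"
      using ex_min_if_finite[of "low ` flips z"] ne by (force simp: not_less)
    with True have "low j < low l" by (meson le_less_trans)
    with not_leads_lower_flip[OF z _ l(2) j(1) _ j(2) \<alpha>] l leads show thesis by blast
  next
    case False
    have "l \<notin> flips z"
    proof
      assume lf: "l \<in> flips z"
      then have "z l \<noteq> low l" by (rule mem_flipsD)
      with xz l(2) have x_low: "x = low l" by (auto simp: D_eq)
      obtain l' where l': "l' \<in> flips z" "\<forall>j\<in>flips z. low l' \<le> low j"
        "q = cell n (compl z - {low l'}) {f, g}"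
        using st lf unfolding state_def by blast
      have "low l = low l'" using False l' lf by (meson le_antisym not_less)
      with x_low l'(3) neq show False by simp
    qed
    then have zl: "z l = low l" using l by (simp add: flips_def)
    with xz l(2) have xh: "x = high l" "low l \<noteq> high l" by (auto simp: D_eq)
    have "low l < low j" if "j \<in> flips z" for j
    proof -
      have "low l \<noteq> low j" using low_inj[of l j] l(1) that \<open>l \<notin> flips z\<close> mem_flipsD(1)[OF that] by blast
      with False that show ?thesis by (meson linorder_neqE_nat)
    qed
    then have "flippable z l" using zl xh l by (simp add: flippable_def)
    with xh(1) show thesis by (rule that[rotated])
  qed
qed

text \<open>A facet drops a map, which passes to cells over a single map, or drops a constant, which
  must be \<open>high l\<close> for a flippable l. The converse also has to check that neither facet
  is the forbidden \<open>q\<close>.\<close>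

lemma path_from_step:
  assumes st: "state z q" and fg: "f \<noteq> g" and \<alpha>: "critical n m \<alpha>"
  shows "path_from n m q (cell n (compl z) {f, g}) ys \<alpha> \<longleftrightarrow>
    (\<exists>h\<in>{f, g}. leads n m (cell n (compl z) {h}) ys \<alpha>) \<or>
    (\<exists>l zs. flippable z l \<and> ys = cell n (compl z - {high l}) {f, g} # zs \<and>
       path_from n m (cell n (compl z - {high l}) {f, g}) (cell n (compl (z(l := high l))) {f, g})
         zs \<alpha>)"
    (is "?P \<longleftrightarrow> ?drop \<or> ?flip")
proof -
  let ?\<tau> = "cell n (compl z) {f, g}"
  have z: "transversal z" using st by (simp add: state_def)
  have q: "q \<in> S n m \<or> q = ?\<tau>" using st by (auto simp: state_def)
  have q_eq: "q = ?\<tau> \<or> (\<exists>l\<in>flips z. q = cell n (compl z - {low l}) {f, g})"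
    using st by (auto simp: state_def)
  have P: "?P \<longleftrightarrow> (\<exists>y. covers ?\<tau> y \<and> y \<noteq> q \<and> leads n m y ys \<alpha>)"
    by (rule path_from_iff_leads[OF \<alpha> q])
  have cov: "covers ?\<tau> y \<longleftrightarrow>
      (\<exists>x\<in>compl z. y = cell n (compl z - {x}) {f, g}) \<or> (\<exists>h\<in>{f, g}. y = cell n (compl z) {h})" for y
  proof -
    have "{f, g} - {f} = {g}" "{f, g} - {g} = {f}" using fg by auto
    then show ?thesis using covers_cell_iff[OF n2 F compl_subset(2), of z y] by auto
  qed
  have flip_leads: "leads n m (cell n (compl z - {high l}) {f, g}) ys \<alpha> \<longleftrightarrow>
      (\<exists>zs. ys = cell n (compl z - {high l}) {f, g} # zs \<and>
         path_from n m (cell n (compl z - {high l}) {f, g}) (cell n (compl (z(l := high l))) {f, g})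
           zs \<alpha>)" if "flippable z l" for l
    using flip_up(1,2)[OF z that] S_not_critical \<alpha> unfolding leads_def by metis
  show ?thesis
  proof
    assume ?P
    then obtain y where y: "covers ?\<tau> y" "y \<noteq> q" "leads n m y ys \<alpha>" using P by blast
    from y(1) show "?drop \<or> ?flip" unfolding cov
    proof (elim disjE bexE)
      fix x assume x: "x \<in> compl z" "y = cell n (compl z - {x}) {f, g}"
      then obtain l where "flippable z l" "x = high l"
        using not_leads_or_flippable[OF st x(1) fg \<alpha>] y by blast
      with flip_leads[of l] y(3) x(2) show ?thesis by blast
    next
      fix h assume "h \<in> {f, g}" "y = cell n (compl z) {h}"
      with y(3) show ?thesis by blast
    qed
  next
    assume "?drop \<or> ?flip"
    then show ?P unfolding P
    proof (elim disjE bexE exE conjE)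
      fix h assume h: "h \<in> {f, g}" "leads n m (cell n (compl z) {h}) ys \<alpha>"
      have "cell n (compl z) {h} \<noteq> cell n Y {f, g}" for Y
        using cell_eq_iff[OF n2, of "{h}" m "{f, g}"] F h(1) fg by auto
      then have "cell n (compl z) {h} \<noteq> q" using q_eq by blast
      with h show "\<exists>y. covers ?\<tau> y \<and> y \<noteq> q \<and> leads n m y ys \<alpha>" using cov by blast
    next
      fix l zs
      assume fl: "flippable z l" and ys: "ys = cell n (compl z - {high l}) {f, g} # zs"
        "path_from n m (cell n (compl z - {high l}) {f, g})
           (cell n (compl (z(l := high l))) {f, g}) zs \<alpha>"
      have l: "l \<in> {1..n} - {k}" "z l = low l" "low l \<noteq> high l"
        using fl by (auto simp: flippable_def)
      note hl = compl_flip(4)[OF z l]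
      \<comment> \<open>Except at the start, \<open>q\<close> arises by deleting the minimum of a
        raised entry, which differs from \<open>high l\<close> by disjointness.\<close>
      have "high l \<noteq> low j" if "j \<in> flips z" for j
      proof
        assume eq: "high l = low j"
        then have "l = j"
          using D_disjoint[of l j "high l"] low_mem[of j] l(1) mem_flipsD(1)[OF that] by (simp add: D_eq)
        with l(2) mem_flipsD(2)[OF that] show False by simp
      qed
      then have "compl z - {high l} \<noteq> compl z - {low j}" if "j \<in> flips z" for j
        using hl that by blast
      moreover have "compl z - {high l} \<noteq> compl z" using hl by blast
      ultimately have "cell n (compl z - {high l}) {f, g} \<noteq> q"
        using q_eq cell_eq_iff[OF n2 F F] by metis
      moreover have "covers ?\<tau> (cell n (compl z - {high l}) {f, g})" using cov hl by blast
      ultimately show "\<exists>y. covers ?\<tau> y \<and> y \<noteq> q \<and> leads n m y ys \<alpha>"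
        using flip_leads[OF fl] ys by blast
    qed
  qed
qed

text \<open>The entries raised so far agree with \<open>h\<close>, and those still to be raised have smaller minima, so the
  forced decreasing order can be continued.\<close>

definition consistent :: "(nat \<Rightarrow> nat) \<Rightarrow> (nat \<Rightarrow> nat) \<Rightarrow> bool" where
  "consistent h z \<longleftrightarrow> (\<forall>j\<in>flips z. h j = z j) \<and>
     (\<forall>j\<in>{1..n} - {k}. z j = low j \<longrightarrow> h j \<noteq> low j \<longrightarrow> (\<forall>i\<in>flips z. low j < low i))"

lemma flippableD:
  assumes "flippable z l"
  shows "l \<in> {1..n} - {k}" "z l = low l" "low l \<noteq> high l" "\<And>j. j \<in> flips z \<Longrightarrow> low l < low j"
    "flips (z(l := high l)) = insert l (flips z)" "l \<notin> flips z"
  using assms flips_flip[of l z] by (simp_all add: flippable_def flips_def)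

lemma consistent_target: "\<forall>j\<in>{1..n} - {k}. z j = h j \<Longrightarrow> consistent h z"
  by (auto simp: consistent_def flips_def)

text \<open>This carries consistency backwards along a path. The last conclusion makes the order
  forced: every other entry still to be raised has a smaller minimum than l.\<close>

lemma consistent_unflip:
  assumes fl: "flippable z l" and c: "consistent h (z(l := high l))"
  shows "consistent h z" "h l = high l"
    and "\<And>j. \<lbrakk>j \<in> {1..n} - {k}; j \<noteq> l; z j = low j; h j \<noteq> low j\<rbrakk> \<Longrightarrow> low j < low l"
proof -
  note l = flippableD[OF fl]
  show hl: "h l = high l" using c l(5) by (auto simp: consistent_def)
  show lower: "low j < low l" if "j \<in> {1..n} - {k}" "j \<noteq> l" "z j = low j" "h j \<noteq> low j" for j
    using c that l(5) unfolding consistent_def by (metis fun_upd_apply insertI1)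
  have "h j = z j" if "j \<in> flips z" for j
    using c that l(5,6) unfolding consistent_def by (metis fun_upd_apply insertI2)
  moreover have "low j < low i"
    if "j \<in> {1..n} - {k}" "z j = low j" "h j \<noteq> low j" "i \<in> flips z" for i j
    using lower[OF that(1) _ that(2,3)] l(4)[OF that(4)] by (cases "j = l") auto
  ultimately show "consistent h z" by (simp add: consistent_def)
qed

text \<open>Take the entry with the largest minimum among those where z still differs from h; the
  others then have smaller minima. The equation for the set of differences makes its size a
  termination measure.\<close>

lemma consistent_flip:
  assumes "h \<in> {f, g}" and z: "transversal z" and c: "consistent h z"
    and "\<not> (\<forall>j\<in>{1..n} - {k}. z j = h j)"
  obtains l where "flippable z l" "consistent h (z(l := high l))"
    "{j \<in> {1..n} - {k}. z j \<noteq> h j} = insert l {j \<in> {1..n} - {k}. (z(l := high l)) j \<noteq> h j}"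
    "(z(l := high l)) l = h l"
proof -
  let ?B = "{j \<in> {1..n} - {k}. z j \<noteq> h j}"
  have B: "z j = low j" "h j = high j" "low j \<noteq> high j" if "j \<in> ?B" for j
  proof -
    show "z j = low j" using that c by (auto simp: consistent_def flips_def)
    moreover have "h j \<in> D j" using assms(1) by (auto simp: D_def)
    ultimately show "h j = high j" "low j \<noteq> high j" using that by (auto simp: D_eq)
  qed
  have "finite ?B" "?B \<noteq> {}" using assms(4) by auto
  then have "Max (low ` ?B) \<in> low ` ?B" by (intro Max_in) auto
  then obtain l where "l \<in> ?B" "Max (low ` ?B) = low l" by blast
  then have l: "l \<in> ?B" "\<And>j. j \<in> ?B \<Longrightarrow> low j \<le> low l"
    using Max_ge[of "low ` ?B"] \<open>finite ?B\<close> by auto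
  have fl: "flippable z l"
    using l(1) B[OF l(1)] c by (auto simp: flippable_def consistent_def)
  note lD = flippableD[OF fl]
  have "consistent h (z(l := high l))"
    unfolding consistent_def lD(5)
  proof (intro conjI ballI impI)
    fix j assume "j \<in> insert l (flips z)"
    then show "h j = (z(l := high l)) j" using B[OF l(1)] c by (auto simp: consistent_def)
  next
    fix j i assume j: "j \<in> {1..n} - {k}" "(z(l := high l)) j = low j" "h j \<noteq> low j"
      and i: "i \<in> insert l (flips z)"
    have jl: "j \<noteq> l" using j(2) lD(3) by auto
    then have jB: "j \<in> ?B" using j by auto
    have "low j \<noteq> low l" using low_inj[of j l] jl j(1) lD(1) by auto
    then have "low j < low l" using l(2)[OF jB] by simp
    then show "low j < low i" using i lD(4)[of i] by auto
  qed
  moreover have "?B = insert l {j \<in> {1..n} - {k}. (z(l := high l)) j \<noteq> h j}"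
    using l(1) by auto
  moreover have "(z(l := high l)) l = h l" using B[OF l(1)] by simp
  ultimately show thesis using fl that by blast
qed

text \<open>As \<open>z j\<close> is neither 1 nor in \<open>compl z\<close>, the inclusion makes it
  a value of h, and disjointness of the \<open>D j\<close> puts this value at position j. The
  criterion of \<open>leads_single_map\<close> thus becomes agreement with h off k.\<close>

lemma leads_drop_iff:
  assumes "m = n + p" and h: "h \<in> {f, g}" and z: "transversal z"
    and Y: "\<And>X ys \<alpha>. \<lbrakk>X \<subseteq> {1..m}; card X = p; critical n m \<alpha>\<rbrakk> \<Longrightarrow>
      leads n m (cell n X {h}) ys \<alpha> \<longleftrightarrow>
      1 \<notin> X \<and> {1..m} - h ` {1..n} - {1} \<subseteq> X \<and> \<alpha> = \<beta> \<and> ys = t X"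
    and \<alpha>: "critical n m \<alpha>"
  shows "leads n m (cell n (compl z) {h}) ys \<alpha> \<longleftrightarrow>
    (\<forall>j\<in>{1..n} - {k}. z j = h j) \<and> \<alpha> = \<beta> \<and> ys = t (compl z)"
proof -
  note mem = mem_compl_iff[of z, OF transversalD(1)[OF z]]
  have "card (compl z) = p" using card_compl[OF z] assms(1) by simp
  moreover have "1 \<notin> compl z" using mem[of 1] by blast
  moreover have "{1..m} - h ` {1..n} - {1} \<subseteq> compl z \<longleftrightarrow> (\<forall>j\<in>{1..n} - {k}. z j = h j)"
  proof
    assume sub: "{1..m} - h ` {1..n} - {1} \<subseteq> compl z"
    show "\<forall>j\<in>{1..n} - {k}. z j = h j"
    proof
      fix j assume j: "j \<in> {1..n} - {k}"
      have "z j \<in> D j" by (rule transversalD(2)[OF z j])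
      then have "z j \<in> {1..m}" "z j \<noteq> 1" using D_subset[of j] one_notin_D[of j] j by auto
      moreover have "z j \<notin> compl z" using mem[of "z j"] j by blast
      ultimately have "z j \<in> h ` {1..n}" using sub by blast
      then obtain i where i: "i \<in> {1..n}" "z j = h i" by blast
      moreover have "h i \<in> D i" using h by (auto simp: D_def)
      ultimately have "i = j" using D_disjoint[of i j "h i"] \<open>z j \<in> D j\<close> j by simp
      with i show "z j = h j" by simp
    qed
  next
    assume eq: "\<forall>j\<in>{1..n} - {k}. z j = h j"
    show "{1..m} - h ` {1..n} - {1} \<subseteq> compl z"
    proof
      fix x assume x: "x \<in> {1..m} - h ` {1..n} - {1}"
      then have "x \<noteq> z j" if "j \<in> {1..n} - {k}" for j using eq that by auto
      with x mem show "x \<in> compl z" by blast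
    qed
  qed
  ultimately show ?thesis using Y[OF compl_subset(1) _ \<alpha>, of z ys] by blast
qed

text \<open>An arbitrary \<open>state\<close> is allowed so that the inductions can pass to the
  state after a raise.\<close>

lemma two_path_ends:
  assumes n3: "3 \<le> n" and m: "m = n + p" and p: "1 \<le> p" and fg: "f \<noteq> g"
  obtains Y where "\<And>h. h \<in> {f, g} \<Longrightarrow> Y h \<subseteq> {1..m} \<and> card (Y h) = p \<and> critical n m (cell n (Y h) {h})"
    and "\<And>z q h. \<lbrakk>state z q; h \<in> {f, g}; consistent h z\<rbrakk> \<Longrightarrow>
      \<exists>!ys. path_from n m q (cell n (compl z) {f, g}) ys (cell n (Y h) {h})"
    and "\<And>z q ys \<alpha>. \<lbrakk>state z q; critical n m \<alpha>; path_from n m q (cell n (compl z) {f, g}) ys \<alpha>\<rbrakk> \<Longrightarrow>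
      \<exists>h\<in>{f, g}. \<alpha> = cell n (Y h) {h}"
proof -
  \<comment> \<open>Packaging the properties in one predicate allows \<open>Y\<close> and
    \<open>t\<close> to be chosen as functions of h.\<close>
  define good where "good h Y t \<longleftrightarrow> Y \<subseteq> {1..m} \<and> card Y = p \<and> critical n m (cell n Y {h}) \<and>
      (\<forall>X ys \<alpha>. X \<subseteq> {1..m} \<longrightarrow> card X = p \<longrightarrow> critical n m \<alpha> \<longrightarrow>
        (leads n m (cell n X {h}) ys \<alpha> \<longleftrightarrow>
         1 \<notin> X \<and> {1..m} - h ` {1..n} - {1} \<subseteq> X \<and> \<alpha> = cell n Y {h} \<and> ys = t X))" for h Y t
  have "\<exists>Y t. good h Y t" if "h \<in> {f, g}" for h
  proof -
    have "h \<in> inj_maps n m" using that F by blast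
    then show ?thesis
      by (rule leads_single_map[OF n3 m p]) (unfold good_def, blast)
  qed
  then obtain Y t where good: "\<And>h. h \<in> {f, g} \<Longrightarrow> good h (Y h) (t h)" by metis
  define \<beta> where "\<beta> h = cell n (Y h) {h}" for h
  have crit: "critical n m (\<beta> h)" if "h \<in> {f, g}" for h
    using good[OF that] by (simp add: good_def \<beta>_def)
  have \<beta>_eq: "h = h'" if "h \<in> {f, g}" "h' \<in> {f, g}" "\<beta> h = \<beta> h'" for h h'
    using that cell_eq_iff[OF n2, of "{h}" m "{h'}"] F by (auto simp: \<beta>_def)
  have drop: "leads n m (cell n (compl z) {h}) ys \<alpha> \<longleftrightarrow>
      (\<forall>j\<in>{1..n} - {k}. z j = h j) \<and> \<alpha> = \<beta> h \<and> ys = t h (compl z)"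
    if "h \<in> {f, g}" "transversal z" "critical n m \<alpha>" for h z ys \<alpha>
    by (rule leads_drop_iff[OF m that(1,2) _ that(3)])
      (use good[OF that(1)] in \<open>simp add: good_def \<beta>_def\<close>)
  have tr: "transversal z" if "state z q" for z q using that by (simp add: state_def)
  have ends: "\<exists>h\<in>{f, g}. \<alpha> = \<beta> h"
    if "state z q" "critical n m \<alpha>" "path_from n m q (cell n (compl z) {f, g}) ys \<alpha>" for z q ys \<alpha>
    using that
  proof (induction ys arbitrary: z q rule: length_induct)
    case (1 ys)
    from 1(4) show ?case
      unfolding path_from_step[OF 1(2) fg 1(3)]
    proof (elim disjE bexE exE conjE)
      fix h assume "h \<in> {f, g}" "leads n m (cell n (compl z) {h}) ys \<alpha>"
      then show ?thesis using drop[of h z \<alpha> ys] tr[OF 1(2)] 1(3) by blast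
    next
      fix l zs
      assume fl: "flippable z l" and ys: "ys = cell n (compl z - {high l}) {f, g} # zs"
        "path_from n m (cell n (compl z - {high l}) {f, g})
           (cell n (compl (z(l := high l))) {f, g}) zs \<alpha>"
      show ?thesis
        using 1(1)[rule_format, of zs "z(l := high l)" "cell n (compl z - {high l}) {f, g}"]
          flip_up(3)[OF tr[OF 1(2)] fl] ys 1(3) by simp
    qed
  qed
  \<comment> \<open>When the path drops h, z agrees with h off k; going back through the raises
    preserves consistency.\<close>
  have consistent: "consistent h z"
    if "state z q" "h \<in> {f, g}" "path_from n m q (cell n (compl z) {f, g}) ys (\<beta> h)" for z q h ys
    using that
  proof (induction ys arbitrary: z q rule: length_induct)
    case (1 ys)
    from 1(4) show ?case
      unfolding path_from_step[OF 1(2) fg crit[OF 1(3)]]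
    proof (elim disjE bexE exE conjE)
      fix h' assume "h' \<in> {f, g}" "leads n m (cell n (compl z) {h'}) ys (\<beta> h)"
      then have "\<forall>j\<in>{1..n} - {k}. z j = h j"
        using drop[of h' z "\<beta> h" ys] tr[OF 1(2)] crit[OF 1(3)] \<beta>_eq[OF 1(3)] by metis
      then show ?thesis by (rule consistent_target)
    next
      fix l zs
      assume fl: "flippable z l" and ys: "ys = cell n (compl z - {high l}) {f, g} # zs"
        "path_from n m (cell n (compl z - {high l}) {f, g})
           (cell n (compl (z(l := high l))) {f, g}) zs (\<beta> h)"
      have "consistent h (z(l := high l))"
        using 1(1)[rule_format, of zs "z(l := high l)" "cell n (compl z - {high l}) {f, g}"]
          flip_up(3)[OF tr[OF 1(2)] fl] ys 1(3) by simp
      then show ?thesis by (rule consistent_unflip[OF fl])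
    qed
  qed
  have unique: "ys = ys'"
    if "state z q" "h \<in> {f, g}" "path_from n m q (cell n (compl z) {f, g}) ys (\<beta> h)"
      "path_from n m q (cell n (compl z) {f, g}) ys' (\<beta> h)" for z q h ys ys'
    using that
  proof (induction ys arbitrary: z q ys' rule: length_induct)
    case (1 ys)
    note z = tr[OF 1(2)]
    have cases: "(\<forall>j\<in>{1..n} - {k}. z j = h j) \<and> vs = t h (compl z) \<or>
        (\<exists>l zs. flippable z l \<and> consistent h (z(l := high l)) \<and>
          state (z(l := high l)) (cell n (compl z - {high l}) {f, g}) \<and>
          vs = cell n (compl z - {high l}) {f, g} # zs \<and>
          path_from n m (cell n (compl z - {high l}) {f, g})
            (cell n (compl (z(l := high l))) {f, g}) zs (\<beta> h))"
      if "path_from n m q (cell n (compl z) {f, g}) vs (\<beta> h)" for vs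
      using that unfolding path_from_step[OF 1(2) fg crit[OF 1(3)]]
    proof (elim disjE bexE exE conjE)
      fix h' assume "h' \<in> {f, g}" "leads n m (cell n (compl z) {h'}) vs (\<beta> h)"
      then show ?thesis
        using drop[of h' z "\<beta> h" vs] z crit[OF 1(3)] \<beta>_eq[OF 1(3)] by metis
    next
      fix l zs
      assume fl: "flippable z l" and vs: "vs = cell n (compl z - {high l}) {f, g} # zs"
        "path_from n m (cell n (compl z - {high l}) {f, g})
           (cell n (compl (z(l := high l))) {f, g}) zs (\<beta> h)"
      with consistent[OF flip_up(3)[OF z fl] 1(3) vs(2)] flip_up(3)[OF z fl] show ?thesis by blast
    qed
    \<comment> \<open>A consistent raise at l has \<open>h l = high l\<close> while
      \<open>z l = low l\<close>, so it cannot start from agreement.\<close>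
    have no_flip: "\<not> (\<forall>j\<in>{1..n} - {k}. z j = h j)"
      if "flippable z l" "consistent h (z(l := high l))" for l
      using consistent_unflip(2)[OF that] flippableD[OF that(1)] by metis
    \<comment> \<open>Two different consistent raises would each require the minimum of the other to
      be smaller.\<close>
    have same: "l = l'"
      if l: "flippable z l" "consistent h (z(l := high l))"
        and l': "flippable z l'" "consistent h (z(l' := high l'))" for l l'
    proof (rule ccontr)
      assume "l \<noteq> l'"
      then have "low l < low l'" "low l' < low l"
        using consistent_unflip(2,3)[OF l] consistent_unflip(2,3)[OF l']
          flippableD[OF l(1)] flippableD[OF l'(1)] by metis+
      then show False by simp
    qed
    from cases[OF 1(4)] show ?case
    proof (elim disjE exE conjE)
      assume "\<forall>j\<in>{1..n} - {k}. z j = h j" "ys = t h (compl z)"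
      with cases[OF 1(5)] no_flip show ?thesis by metis
    next
      fix l zs
      assume l: "flippable z l" "consistent h (z(l := high l))"
        and st: "state (z(l := high l)) (cell n (compl z - {high l}) {f, g})"
        and ys: "ys = cell n (compl z - {high l}) {f, g} # zs"
          "path_from n m (cell n (compl z - {high l}) {f, g})
            (cell n (compl (z(l := high l))) {f, g}) zs (\<beta> h)"
      obtain l' zs' where l': "flippable z l'" "consistent h (z(l' := high l'))"
        and ys': "ys' = cell n (compl z - {high l'}) {f, g} # zs'"
          "path_from n m (cell n (compl z - {high l'}) {f, g})
            (cell n (compl (z(l' := high l'))) {f, g}) zs' (\<beta> h)"
        using cases[OF 1(5)] no_flip[OF l] by blast
      have "l' = l" by (rule same[OF l' l])
      then have "zs = zs'"
        using 1(1)[rule_format, OF _ st 1(3) ys(2), of zs'] ys' ys(1) by simp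
      with \<open>l' = l\<close> ys(1) ys'(1) show ?thesis by simp
    qed
  qed
  \<comment> \<open>The induction is on the number of entries in which z still differs from
    h.\<close>
  have exists: "\<exists>ys. path_from n m q (cell n (compl z) {f, g}) ys (\<beta> h)"
    if "state z q" "h \<in> {f, g}" "consistent h z" for z q h
    using that
  proof (induction "card {j \<in> {1..n} - {k}. z j \<noteq> h j}" arbitrary: z q rule: less_induct)
    case less
    note z = tr[OF less(2)]
    show ?case
    proof (cases "\<forall>j\<in>{1..n} - {k}. z j = h j")
      case True
      then have "leads n m (cell n (compl z) {h}) (t h (compl z)) (\<beta> h)"
        using drop[OF less(3) z crit[OF less(3)]] by blast
      then show ?thesis
        using path_from_step[OF less(2) fg crit[OF less(3)]] less(3) by blast
    next
      case False
      then obtain l where l: "flippable z l" "consistent h (z(l := high l))"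
        "{j \<in> {1..n} - {k}. z j \<noteq> h j} = insert l {j \<in> {1..n} - {k}. (z(l := high l)) j \<noteq> h j}"
        "(z(l := high l)) l = h l"
        by (rule consistent_flip[OF less(3) z less(4)])
      have "card {j \<in> {1..n} - {k}. (z(l := high l)) j \<noteq> h j} < card {j \<in> {1..n} - {k}. z j \<noteq> h j}"
        unfolding l(3) using l(4) by (subst card_insert_disjoint) auto
      from less(1)[OF this flip_up(3)[OF z l(1)] less(3) l(2)]
      show ?thesis
        using path_from_step[OF less(2) fg crit[OF less(3)]] l(1) by blast
    qed
  qed
  show thesis
  proof (rule that[of Y])
    show "Y h \<subseteq> {1..m} \<and> card (Y h) = p \<and> critical n m (cell n (Y h) {h})" if "h \<in> {f, g}" for h
      using good[OF that] by (simp add: good_def)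
    show "\<exists>!ys. path_from n m q (cell n (compl z) {f, g}) ys (cell n (Y h) {h})"
      if "state z q" "h \<in> {f, g}" "consistent h z" for z q h
      using exists[OF that] unique[OF that(1,2)] unfolding \<beta>_def by blast
    show "\<exists>h\<in>{f, g}. \<alpha> = cell n (Y h) {h}"
      if "state z q" "critical n m \<alpha>" "path_from n m q (cell n (compl z) {f, g}) ys \<alpha>" for z q ys \<alpha>
      using ends[OF that] unfolding \<beta>_def .
  qed
qed

end

section \<open>From the critical cell to its two endpoints\<close>

theorem theorem4p15:
  fixes m n p k :: nat
    and z f1 f2 :: "nat \<Rightarrow> nat"
    and T :: "nat set"
    and \<sigma> :: "(nat \<Rightarrow> nat) set"
  assumes "n \<ge> 3" and "m = n + p" and "p \<ge> 1"
    and "z \<in> inj_maps n m" and "k \<in> {1..n}" and "z k = 1"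
    and "T = {1..m} - z ` {1..n}"
    and "f1 \<in> inj_maps n m" and "f2 \<in> inj_maps n m" and "f1 \<noteq> f2"
    and "\<sigma> = const_map n ` T \<union> {f1, f2}"
    and "\<sigma> \<subseteq> common_nbrs n m {z}"
    and "critical_cell n m (p + 1) \<sigma>"
  shows "\<exists>\<beta> \<gamma>. \<beta> \<noteq> \<gamma> \<and> critical_cell n m p \<beta> \<and> critical_cell n m p \<gamma> \<and>
           (\<exists>!w. alt_path n m \<sigma> \<beta> w) \<and> (\<exists>!w. alt_path n m \<sigma> \<gamma> w) \<and>
           (\<forall>\<alpha>. critical_cell n m p \<alpha> \<and> \<alpha> \<noteq> \<beta> \<and> \<alpha> \<noteq> \<gamma> \<longrightarrow> \<not> (\<exists>w. alt_path n m \<sigma> \<alpha> w))"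
proof -
  have n2: "2 \<le> n" using assms(1) by simp
  have F: "{f1, f2} \<subseteq> inj_maps n m" using assms(8,9) by simp
  have \<sigma>: "\<sigma> = cell n T {f1, f2}" by (simp add: assms(11) cell_def)
  have T: "T \<subseteq> {1..m}" using assms(7) by blast
  have crit: "critical n m (cell n T {f1, f2})" and card_\<sigma>: "card \<sigma> = p + 2"
    using assms(13) \<sigma> by (simp_all add: critical_cell_def)
  have adj: "adj n f1 f2"
    unfolding adj_def
  proof (intro ballI impI)
    fix i j assume ij: "i \<in> {1..n}" "j \<in> {1..n}" "i \<noteq> j"
    show "f1 i \<noteq> f2 j"
    proof
      assume eq: "f1 i = f2 j"
      \<comment> \<open>A common neighbour with this value at l would need l = i by adjacency to
        \<open>f1\<close> and l = j by adjacency to \<open>f2\<close>.\<close>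
      have "f1 i \<notin> w ` {1..n}" if w: "w \<in> common_nbrs n m {f1, f2}" for w
      proof
        assume "f1 i \<in> w ` {1..n}"
        then obtain l where "l \<in> {1..n}" "f1 i = w l" by blast
        moreover have "adj n f1 w" "adj n f2 w" using w by (simp_all add: common_nbrs_def)
        ultimately show False using ij eq unfolding adj_def by metis
      qed
      then have "\<not> critical n m (cell n T {f1, f2})"
        by (intro not_critical_of_unused[OF n2 F _ inj_mapsD(1)[OF assms(8) ij(1)] _ T]) auto
      with crit show False by simp
    qed
  qed
  let ?U = "f1 ` {1..n} \<union> f2 ` {1..n}"
  have U: "finite ?U" "?U \<noteq> {}" using n2 by auto
  obtain k' where k': "k' \<in> {1..n}" "Min ?U \<in> {f1 k', f2 k'}"
    using Min_in[OF U] by blast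
  interpret adjacent_pair n m k' "Min ?U" f1 f2
  proof
    fix j assume "j \<in> {1..n}"
    then show "Min ?U \<le> f1 j \<and> Min ?U \<le> f2 j" using U(1) by auto
  qed (use n2 assms(8,9) adj k' in auto)
  have T_eq: "T = compl lowest" using critical_cell_iff[OF T] crit by blast
  \<comment> \<open>No entry is raised yet, so \<sigma> serves as the dummy
    \<open>q\<close>.\<close>
  have st: "state lowest \<sigma>"
    unfolding state_def using transversal_lowest \<sigma> T_eq by (auto simp: flips_def lowest_def)
  \<comment> \<open>With nothing raised both conditions are vacuous, so \<open>f1\<close> and
    \<open>f2\<close> are both reached.\<close>
  have cons: "consistent h lowest" for h
    by (auto simp: consistent_def flips_def lowest_def)
  from two_path_ends[OF assms(1,2,3,10)] obtain Y where
    Y: "\<And>h. h \<in> {f1, f2} \<Longrightarrow> Y h \<subseteq> {1..m} \<and> card (Y h) = p \<and> critical n m (cell n (Y h) {h})"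
    and ex1: "\<And>z q h. \<lbrakk>state z q; h \<in> {f1, f2}; consistent h z\<rbrakk> \<Longrightarrow>
      \<exists>!ys. path_from n m q (cell n (compl z) {f1, f2}) ys (cell n (Y h) {h})"
    and ends: "\<And>z q ys \<alpha>. \<lbrakk>state z q; critical n m \<alpha>;
      path_from n m q (cell n (compl z) {f1, f2}) ys \<alpha>\<rbrakk> \<Longrightarrow> \<exists>h\<in>{f1, f2}. \<alpha> = cell n (Y h) {h}"
    by blast
  define \<beta> where "\<beta> h = cell n (Y h) {h}" for h
  have card_\<beta>: "card (\<beta> h) = p + 1" if "h \<in> {f1, f2}" for h
    using card_cell[OF n2, of "{h}" m "Y h"] Y[OF that] F that finite_subset[of "Y h" "{1..m}"]
    by (auto simp: \<beta>_def)
  have cell_\<beta>: "critical_cell n m p (\<beta> h)" if "h \<in> {f1, f2}" for h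
    using Y[OF that] card_\<beta>[OF that] by (simp add: critical_cell_def \<beta>_def)
  have path: "\<exists>!w. alt_path n m \<sigma> (\<beta> h) w" if "h \<in> {f1, f2}" for h
  proof (rule alt_path_ex1)
    show "critical n m \<sigma>" using crit \<sigma> by simp
    show "critical n m (\<beta> h)" using Y[OF that] by (simp add: \<beta>_def)
    show "card \<sigma> = card (\<beta> h) + 1" using card_\<beta>[OF that] card_\<sigma> by simp
    show "\<exists>!ys. path_from n m \<sigma> \<sigma> ys (\<beta> h)"
      using ex1[OF st that cons] \<sigma> T_eq by (simp add: \<beta>_def)
  qed
  have distinct: "\<beta> f1 \<noteq> \<beta> f2"
    using cell_eq_iff[OF n2, of "{f1}" m "{f2}"] F assms(10) by (simp add: \<beta>_def)
  have no_path: "\<not> (\<exists>w. alt_path n m \<sigma> \<alpha> w)" if "\<alpha> \<noteq> \<beta> f1" "\<alpha> \<noteq> \<beta> f2" for \<alpha>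
  proof
    assume "\<exists>w. alt_path n m \<sigma> \<alpha> w"
    then obtain ys where "critical n m \<alpha>" "path_from n m \<sigma> \<sigma> ys \<alpha>"
      unfolding alt_path_iff by blast
    then have "\<exists>h\<in>{f1, f2}. \<alpha> = \<beta> h"
      using ends[OF st, of \<alpha> ys] unfolding \<beta>_def \<sigma> T_eq by blast
    with that show False by blast
  qed
  show ?thesis
  proof (rule exI[of _ "\<beta> f1"], rule exI[of _ "\<beta> f2"], intro conjI)
    show "\<forall>\<alpha>. critical_cell n m p \<alpha> \<and> \<alpha> \<noteq> \<beta> f1 \<and> \<alpha> \<noteq> \<beta> f2 \<longrightarrow> \<not> (\<exists>w. alt_path n m \<sigma> \<alpha> w)"
      using no_path by blast
  qed (use distinct in \<open>simp_all only: cell_\<beta> path insertI1 insertI2 simp_thms\<close>)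
qed

end
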